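(* Let $X$ be an elliptic or hyperbolic affine polar graph, i.e. $X=VO^-(2e,q)$ or $X=VO^+(2e,q)$ with $q$ a prime power, and let $u$ and $v$ be distinct, non-adjacent vertices of $X$. If $q$ is even, then the perturbation $X^{\beta,\gamma}_{u,v}$ of $X$ at vertices $u,v$ with weights $\beta,\gamma$, for some $\beta,\gamma$ with $\beta+\gamma=0$ and $\beta\in\mathbb{Q}$, admits perfect state transfer from $u$ to $v$.
   Context: For a prime power $q$ and a positive integer $e$, let $Q$ be a nondegenerate quadratic form on $V=\mathbb{F}_q^{2e}$ of elliptic type (respectively hyperbolic type). The elliptic affine polar graph $VO^-(2e,q)$ (respectively hyperbolic affine polar graph $VO^+(2e,q)$) of order $(2e,q)$ is the point graph of the corresponding affine polar space: its vertex set is $V$, and distinct $x,y\in V$ are adjacent if and only if $Q(x-y)=0$. These graphs give infinite families of strongly regular graphs, on $q^{2e}$ vertices, with valency $(q^{e-1}-1)(q^e+1)$ in the elliptic case and $(q^{e-1}+1)(q^e-1)$ in the hyperbolic case. For a graph $X$ with adjacency matrix $A$, distinct vertices $u,v$ and real $\beta,\gamma$, $X^{\beta,\gamma}_{u,v}$ is the weighted graph with adjacency matrix $A+H$, where $H=\beta(e_ue_v^T+e_ve_u^T)+\gamma(e_ue_u^T+e_ve_v^T)$ and $e_w$ denotes the standard basis vector indexed by $w$. For a (weighted) graph with real symmetric adjacency matrix $M$, let $U(t)=\exp(itM)$. There is perfect state transfer from $u$ to $v$ if $|U(t)_{u,v}|=1$ for some $t>0$.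
   Formalization: The single graph VO^+(2,4) (hyperbolic, e=1, q=4: the 4×4 rook's graph) is excluded, since there no β,γ with β+γ=0 give perfect state transfer between distinct non-adjacent vertices; all other cases are covered. *)

theory Defs
  imports "HOL-Analysis.Analysis"
begin

section \<open>Quadratic forms over finite fields\<close>

definition polar_form :: "('a::field ^ 'n \<Rightarrow> 'a) \<Rightarrow> 'a ^ 'n \<Rightarrow> 'a ^ 'n \<Rightarrow> 'a" where
  "polar_form Q x y = Q (x + y) - Q x - Q y"

definition quadratic_form :: "('a::field ^ 'n \<Rightarrow> 'a) \<Rightarrow> bool" where
  "quadratic_form Q \<longleftrightarrow>
     (\<forall>c x. Q (c *s x) = c\<^sup>2 * Q x) \<and>
     (\<forall>y. Vector_Spaces.linear (*s) (*) (\<lambda>x. polar_form Q x y)) \<and>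
     (\<forall>x. Vector_Spaces.linear (*s) (*) (\<lambda>y. polar_form Q x y))"

text \<open>
  Nondegeneracy in the sense valid in every characteristic: the radical of the polar form
  contains no nonzero singular vector.
\<close>

definition nondegenerate_form :: "('a::field ^ 'n \<Rightarrow> 'a) \<Rightarrow> bool" where
  "nondegenerate_form Q \<longleftrightarrow> (\<forall>x. (\<forall>y. polar_form Q x y = 0) \<and> Q x = 0 \<longrightarrow> x = 0)"

definition totally_singular :: "('a::field ^ 'n \<Rightarrow> 'a) \<Rightarrow> ('a ^ 'n) set \<Rightarrow> bool" where
  "totally_singular Q W \<longleftrightarrow> vec.subspace W \<and> (\<forall>x\<in>W. Q x = 0)"

definition witt_index :: "('a::{field,finite} ^ 'n \<Rightarrow> 'a) \<Rightarrow> nat" where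
  "witt_index Q = Max {vec.dim W | W. totally_singular Q W}"

text \<open>
  On a space of dimension \<open>2 * e\<close> the hyperbolic forms are those of Witt index \<open>e\<close> and
  the elliptic ones those of Witt index \<open>e - 1\<close>; the equations below avoid natural number
  division and subtraction.
\<close>

definition hyperbolic_form :: "('a::{field,finite} ^ 'n \<Rightarrow> 'a) \<Rightarrow> bool" where
  "hyperbolic_form Q \<longleftrightarrow>
     quadratic_form Q \<and> nondegenerate_form Q \<and> 2 * witt_index Q = CARD('n)"

definition elliptic_form :: "('a::{field,finite} ^ 'n \<Rightarrow> 'a) \<Rightarrow> bool" where
  "elliptic_form Q \<longleftrightarrow>
     quadratic_form Q \<and> nondegenerate_form Q \<and> 2 * (witt_index Q + 1) = CARD('n)"


section \<open>Affine polar graphs\<close>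

text \<open>
  The vertex set is the whole type \<open>'a ^ 'n\<close>. The graph is VO-minus for an elliptic form
  \<open>Q\<close> and VO-plus for a hyperbolic one.

  The hyperbolic graph with \<open>e = 1\<close> and \<open>q = 4\<close> (the 4 by 4 rook's graph) is exceptional: for distinct
  non-adjacent vertices no perturbation with \<open>\<beta> + \<gamma> = 0\<close> admits perfect state transfer, so results
  on perfect state transfer with such weights have to exclude it.
\<close>

definition affine_polar_adj :: "('a::field ^ 'n \<Rightarrow> 'a) \<Rightarrow> 'a ^ 'n \<Rightarrow> 'a ^ 'n \<Rightarrow> bool" where
  "affine_polar_adj Q x y \<longleftrightarrow> x \<noteq> y \<and> Q (x - y) = 0"


section \<open>Perturbed graphs and perfect state transfer\<close>

definition adjacency_matrix :: "('v \<Rightarrow> 'v \<Rightarrow> bool) \<Rightarrow> real ^ 'v ^ 'v" where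
  "adjacency_matrix E = (\<chi> x y. if E x y then 1 else 0)"

definition outer_product :: "real ^ 'v \<Rightarrow> real ^ 'v \<Rightarrow> real ^ 'v ^ 'v" where
  "outer_product a b = (\<chi> i j. a $ i * b $ j)"

definition perturbation ::
    "real ^ 'v ^ 'v \<Rightarrow> 'v \<Rightarrow> 'v \<Rightarrow> real \<Rightarrow> real \<Rightarrow> real ^ 'v ^ 'v" where
  "perturbation A u v \<beta> \<gamma> =
     A + (\<beta> *\<^sub>R (outer_product (axis u 1) (axis v 1) + outer_product (axis v 1) (axis u 1))
        + \<gamma> *\<^sub>R (outer_product (axis u 1) (axis u 1) + outer_product (axis v 1) (axis v 1)))"

text \<open>
  The matrix power has to be defined with \<open>**\<close>: the operations \<open>*\<close> and
  \<open>^\<close> on the type of matrices act entrywise, so \<open>exp\<close> and \<open>power\<close> are not usable.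
\<close>

primrec matrix_power :: "complex ^ 'v ^ 'v \<Rightarrow> nat \<Rightarrow> complex ^ 'v ^ 'v" where
  "matrix_power M 0 = mat 1"
| "matrix_power M (Suc n) = M ** matrix_power M n"

definition matrix_exp :: "complex ^ 'v ^ 'v \<Rightarrow> complex ^ 'v ^ 'v" where
  "matrix_exp M = (\<Sum>n. (1 / fact n) *\<^sub>R matrix_power M n)"

definition transition_matrix :: "real ^ 'v ^ 'v \<Rightarrow> real \<Rightarrow> complex ^ 'v ^ 'v" where
  "transition_matrix M t = matrix_exp (\<chi> x y. \<i> * complex_of_real (t * M $ x $ y))"

definition perfect_state_transfer :: "real ^ 'v ^ 'v \<Rightarrow> 'v \<Rightarrow> 'v \<Rightarrow> bool" where
  "perfect_state_transfer M u v \<longleftrightarrow> (\<exists>t>0. cmod (transition_matrix M t $ u $ v) = 1)"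

end

theory Submission
  imports Defs
begin

text \<open>
  With \<open>\<gamma> = - \<beta>\<close> the perturbed matrix is the rank one update \<open>M = A - \<beta> (e\<^sub>u - e\<^sub>v) (e\<^sub>u - e\<^sub>v)\<^sup>T\<close>.
  State transfer at time \<open>t\<close> follows once \<open>exp (i t M)\<close> multiplies \<open>e\<^sub>u + e\<^sub>v\<close> by a phase \<open>\<rho>\<close> and
  \<open>e\<^sub>u - e\<^sub>v\<close> by \<open>- \<rho>\<close>. Both vectors lie in small \<open>M\<close>-invariant spaces when \<open>A\<close> is strongly regular with
  restricted eigenvalues \<open>\<theta> > \<tau>\<close> and valency \<open>k\<close>. On the cyclic space of \<open>e\<^sub>u + e\<^sub>v\<close> the update
  vanishes, so only \<open>k, \<theta>, \<tau>\<close> occur. The cyclic space of \<open>e\<^sub>u - e\<^sub>v\<close> is spanned by this vector and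
  its image under \<open>A\<close>; there \<open>M\<close> has two eigenvalues \<open>\<mu>, \<nu>\<close> with
  \<open>\<mu> + \<nu> = \<theta> + \<tau> - 2 \<beta>\<close> and \<open>\<mu> \<nu> = \<theta> \<tau> - 2 \<beta> (\<theta> + \<tau>)\<close>.

  For an affine polar graph \<open>D = \<theta> - \<tau> = q^e\<close>, and \<open>k - \<theta>\<close> is a multiple of \<open>D\<close>. At a time
  \<open>t = 2 \<pi> r / D\<close> with integral \<open>r\<close> the three phases of the symmetric part therefore agree, and
  the requirement on the alternating part becomes \<open>\<mu> = \<theta> + D a / (2 r)\<close>,
  \<open>\<nu> = \<theta> + D a' / (2 r)\<close> with \<open>a, a'\<close> odd. Eliminating \<open>\<beta>\<close> leaves the Diophantine equation
  \<open>D a a' = 2 r \<tau> (a + a' + 2 r)\<close>. If \<open>\<tau> = b \<tau>'\<close> with \<open>\<tau>'\<close> odd and \<open>D = 4 b D'\<close>, it is solved by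
  \<open>a = 3 \<tau>'\<close> and \<open>a' = r = 2 D' - \<tau>'\<close>: this is \<open>perfect_state_transfer_2_adic\<close>. For even \<open>q\<close> and
  \<open>e \<ge> 2\<close> the eigenvalue \<open>\<tau>\<close> is odd and \<open>4\<close> divides \<open>D\<close>, so \<open>b = 1\<close> works. For \<open>e = 1\<close> the
  elliptic graph has no edges and the hyperbolic graph has \<open>\<tau> = - 2\<close> and \<open>D = q\<close>; then
  \<open>b = 2\<close> works if \<open>8\<close> divides \<open>q\<close>, and \<open>q = 2\<close> gives the four-cycle, where already
  \<open>\<beta> = 0\<close> succeeds.

  The parameters of the graph come from the sum \<open>G\<close> of \<open>\<psi> (Q x)\<close> over the space, for an additive
  character \<open>\<psi>\<close> of order two. Averaging over a maximal totally singular subspace shows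
  \<open>G = q^e\<close> in the hyperbolic and \<open>G = - q^e\<close> in the elliptic case
  (\<open>gauss_hyperbolic\<close>, \<open>gauss_elliptic\<close>). As every element of the field is a square, the
  function \<open>q [Q z = 0] - 1\<close> is an eigenfunction of the Fourier transform with eigenvalue \<open>G\<close>
  (\<open>zero_weight_fourier\<close>), and squaring its two values gives the quadratic equation
  for the adjacency matrix (\<open>A_square\<close>).
\<close>

section \<open>The matrix exponential on eigenvectors\<close>

text \<open>
  This bound compares the exponential series of \<open>M\<close> with the real exponential series at
  \<open>real CARD('v) * c\<close>, which gives convergence.
\<close>

lemma matrix_power_entry_bound:
  fixes M :: "complex ^ 'v ^ 'v"
  assumes c: "\<And>i j. cmod (M $ i $ j) \<le> c"
  shows "cmod (matrix_power M n $ i $ j) \<le> (real CARD('v) * c) ^ n"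
proof (induction n arbitrary: i j)
  case 0
  then show ?case by (simp add: mat_def)
next
  case (Suc n)
  have c0: "0 \<le> c" using c[of i j] norm_ge_zero order_trans by blast
  have "cmod (matrix_power M (Suc n) $ i $ j)
      = cmod (\<Sum>k\<in>UNIV. M $ i $ k * matrix_power M n $ k $ j)"
    by (simp add: matrix_matrix_mult_def)
  also have "\<dots> \<le> (\<Sum>k\<in>(UNIV::'v set). c * (real CARD('v) * c) ^ n)"
    by (intro sum_norm_le) (unfold norm_mult, intro mult_mono c Suc.IH c0 norm_ge_zero)
  finally show ?case by simp
qed

lemma summable_matrix_exp:
  fixes M :: "complex ^ 'v ^ 'v"
  shows "summable (\<lambda>n. (1 / fact n) *\<^sub>R matrix_power M n)"
proof -
  define c where "c = (\<Sum>i\<in>UNIV. \<Sum>j\<in>UNIV. cmod (M $ i $ j))"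
  have c: "cmod (M $ i $ j) \<le> c" for i j
  proof -
    have "cmod (M $ i $ j) \<le> (\<Sum>j\<in>UNIV. cmod (M $ i $ j))"
      by (rule member_le_sum[where f = "\<lambda>j. cmod (M $ i $ j)"]) auto
    also have "\<dots> \<le> c"
      unfolding c_def by (rule member_le_sum[where f = "\<lambda>i. \<Sum>j\<in>UNIV. cmod (M $ i $ j)"]) (auto intro: sum_nonneg)
    finally show ?thesis .
  qed
  let ?C = "real CARD('v) * c"
  let ?K = "real CARD('v) * real CARD('v)"
  have nrm: "norm (X :: complex ^ 'v ^ 'v) \<le> (\<Sum>i\<in>UNIV. \<Sum>j\<in>UNIV. cmod (X $ i $ j))" for X
  proof -
    have "norm X \<le> (\<Sum>i\<in>UNIV. norm (X $ i))"
      unfolding norm_vec_def by (rule L2_set_le_sum) auto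
    also have "\<dots> \<le> (\<Sum>i\<in>UNIV. \<Sum>j\<in>UNIV. cmod (X $ i $ j))"
      by (intro sum_mono) (unfold norm_vec_def, rule L2_set_le_sum, auto)
    finally show ?thesis .
  qed
  have bound: "norm ((1 / fact n) *\<^sub>R matrix_power M n) \<le> ?K * (inverse (fact n) *\<^sub>R ?C ^ n)" for n
  proof -
    have "norm (matrix_power M n) \<le> (\<Sum>i\<in>(UNIV::'v set). \<Sum>j\<in>(UNIV::'v set). ?C ^ n)"
      by (rule order_trans[OF nrm]) (intro sum_mono matrix_power_entry_bound c)
    then have "norm (matrix_power M n) \<le> ?K * ?C ^ n"
      by (simp only: sum_constant mult.assoc)
    then have "norm (matrix_power M n) / fact n \<le> (?K * ?C ^ n) / fact n"
      by (rule divide_right_mono) simp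
    then show ?thesis by (simp add: divide_inverse mult.commute mult.left_commute)
  qed
  have "summable (\<lambda>n. ?K * (inverse (fact n) *\<^sub>R ?C ^ n))"
    by (intro summable_mult summable_exp_generic)
  then show ?thesis by (rule summable_comparison_test'[where N = 0]) (rule bound)
qed

lemma matrix_exp_eigenvector:
  fixes M :: "complex ^ 'v ^ 'v"
  assumes eig: "M *v f = \<mu> *s f"
  shows "matrix_exp M *v f = exp \<mu> *s f"
proof -
  have pow: "matrix_power M n *v f = \<mu> ^ n *s f" for n
    by (induction n)
      (simp_all add: eig matrix_vector_mul_assoc[symmetric] vector_scalar_commute mult.commute)
  have lin: "bounded_linear (\<lambda>X::complex ^ 'v ^ 'v. X *v f)"
    by (rule linear_conv_bounded_linear[THEN iffD1], rule linearI)
      (simp_all add: vec_eq_iff matrix_vector_mult_def sum.distrib scaleR_sum_right algebra_simps)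
  have lin2: "bounded_linear (\<lambda>c::complex. c *s f)"
    by (rule linear_conv_bounded_linear[THEN iffD1], rule linearI)
      (simp_all add: vec_eq_iff algebra_simps)
  have "matrix_exp M *v f = (\<Sum>n. ((1 / fact n) *\<^sub>R matrix_power M n) *v f)"
    unfolding matrix_exp_def by (rule bounded_linear.suminf[OF lin summable_matrix_exp])
  also have "\<dots> = (\<Sum>n. (\<mu> ^ n /\<^sub>R fact n) *s f)"
    unfolding linear_cmul[OF bounded_linear.linear[OF lin]] pow
    by (rule suminf_cong) (simp add: vec_eq_iff inverse_eq_divide)
  also have "\<dots> = (\<Sum>n. \<mu> ^ n /\<^sub>R fact n) *s f"
    by (rule bounded_linear.suminf[OF lin2 summable_exp_generic, symmetric])
  finally show ?thesis by (simp add: exp_def)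
qed

definition complex_vec :: "real ^ 'v \<Rightarrow> complex ^ 'v" where
  "complex_vec f = (\<chi> x. complex_of_real (f $ x))"

lemma complex_vec_lincomb:
  "complex_vec (f + g) = complex_vec f + complex_vec g"
  "complex_vec (f - g) = complex_vec f - complex_vec g"
  "complex_vec (c *\<^sub>R f) = complex_of_real c *s complex_vec f"
  by (simp_all add: complex_vec_def vec_eq_iff)

lemma transition_matrix_eigenvector:
  fixes M :: "real ^ 'v ^ 'v"
  assumes "M *v f = \<mu> *\<^sub>R f"
  shows "transition_matrix M t *v complex_vec f = exp (\<i> * of_real (t * \<mu>)) *s complex_vec f"
  unfolding transition_matrix_def
proof (rule matrix_exp_eigenvector)
  show "(\<chi> x y. \<i> * complex_of_real (t * M $ x $ y)) *v complex_vec f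
      = (\<i> * of_real (t * \<mu>)) *s complex_vec f"
  proof (rule vec_eq_iff[THEN iffD2], rule allI)
    fix x
    have "complex_of_real (\<Sum>y\<in>UNIV. M $ x $ y * f $ y) = of_real (\<mu> * f $ x)"
      using assms by (simp add: vec_eq_iff matrix_vector_mult_def)
    then show "((\<chi> x y. \<i> * complex_of_real (t * M $ x $ y)) *v complex_vec f) $ x
        = ((\<i> * of_real (t * \<mu>)) *s complex_vec f) $ x"
      by (simp add: matrix_vector_mult_def complex_vec_def sum_distrib_left[symmetric] mult.assoc)
  qed
qed

text \<open>
  A vector annihilated by \<open>(M - \<mu>) (M - \<nu>)\<close> is a combination of eigenvectors for \<open>\<mu>\<close> and \<open>\<nu>\<close>;
  this yields the phase of the vector without decomposing the whole space.
\<close>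

lemma transition_matrix_two_eigenvalues:
  fixes M :: "real ^ 'v ^ 'v"
  assumes quad: "M *v (M *v f) = (\<mu> + \<nu>) *\<^sub>R (M *v f) - (\<mu> * \<nu>) *\<^sub>R f"
    and ne: "\<mu> \<noteq> \<nu>"
    and ev: "exp (\<i> * of_real (t * \<mu>)) = \<rho>" "exp (\<i> * of_real (t * \<nu>)) = \<rho>"
  shows "transition_matrix M t *v complex_vec f = \<rho> *s complex_vec f"
proof -
  define g where "g = M *v f - \<nu> *\<^sub>R f"
  define h where "h = M *v f - \<mu> *\<^sub>R f"
  have Mg: "M *v g = \<mu> *\<^sub>R g" and Mh: "M *v h = \<nu> *\<^sub>R h"
    unfolding g_def h_def
    by (simp_all add: matrix_vector_mult_diff_distrib matrix_vector_mult_scaleR quad algebra_simps)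
  have "(\<mu> - \<nu>) *\<^sub>R f = g - h" by (simp add: g_def h_def algebra_simps)
  then have "f = (1 / (\<mu> - \<nu>)) *\<^sub>R (g - h)" using ne by (simp add: eq_vector_fraction_iff)
  then have f: "complex_vec f = of_real (1 / (\<mu> - \<nu>)) *s (complex_vec g - complex_vec h)"
    by (metis complex_vec_lincomb(2,3))
  show ?thesis
    unfolding f using transition_matrix_eigenvector[OF Mg, of t] transition_matrix_eigenvector[OF Mh, of t] ev
    by (simp add: vector_scalar_commute matrix_vector_mult_diff_distrib
      vector_ssub_ldistrib mult.commute)
qed

text \<open>
  Since \<open>2 e\<^sub>v\<close> is the difference of \<open>e\<^sub>u + e\<^sub>v\<close> and \<open>e\<^sub>u - e\<^sub>v\<close>, opposite phases on these vectors
  carry \<open>e\<^sub>v\<close> to a unit multiple of \<open>e\<^sub>u\<close>.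
\<close>

lemma perfect_state_transferI:
  fixes M :: "real ^ 'v ^ 'v"
  assumes t: "t > 0" and lam: "cmod \<rho> = 1"
    and sym: "transition_matrix M t *v complex_vec (axis u 1 + axis v 1)
      = \<rho> *s complex_vec (axis u 1 + axis v 1)"
    and alt: "transition_matrix M t *v complex_vec (axis u 1 - axis v 1)
      = (- \<rho>) *s complex_vec (axis u 1 - axis v 1)"
  shows "perfect_state_transfer M u v"
proof -
  let ?U = "transition_matrix M t"
  have "?U *v complex_vec (axis u 1 + axis v 1) - ?U *v complex_vec (axis u 1 - axis v 1)
      = (2 * \<rho>) *s axis u 1"
    unfolding sym alt by (simp add: complex_vec_def vec_eq_iff axis_def)
  moreover have "?U *v complex_vec (axis u 1 + axis v 1) - ?U *v complex_vec (axis u 1 - axis v 1)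
      = ?U *v (2 *s axis v 1)"
    unfolding matrix_vector_mult_diff_distrib[symmetric]
    by (rule arg_cong[where f = "(*v) ?U"]) (simp add: complex_vec_def vec_eq_iff axis_def)
  ultimately have "(?U *v (2 *s axis v 1)) $ u = ((2 * \<rho>) *s axis u 1) $ u" by simp
  then have "?U $ u $ v = \<rho>"
    by (simp add: matrix_vector_mult_def axis_def if_distrib cong: if_cong)
  then show ?thesis using t lam unfolding perfect_state_transfer_def by auto
qed

section \<open>Perturbed strongly regular matrices\<close>

text \<open>
  The choice \<open>\<gamma> = - \<beta>\<close> makes the perturbation a multiple of the outer square of \<open>e\<^sub>u - e\<^sub>v\<close>, so
  it sees a vector only through the difference of its entries at \<open>u\<close> and \<open>v\<close>.
\<close>

lemma perturbation_mult_vec: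
  fixes A :: "real ^ 'v ^ 'v"
  shows "perturbation A u v \<beta> (- \<beta>) *v h = A *v h - (\<beta> * (h $ u - h $ v)) *\<^sub>R (axis u 1 - axis v 1)"
proof -
  have "outer_product a b *v h = (\<Sum>j\<in>UNIV. b $ j * h $ j) *\<^sub>R a" for a b :: "real ^ 'v"
    by (simp add: vec_eq_iff outer_product_def matrix_vector_mult_def sum_distrib_right sum_distrib_left ac_simps)
  then have op: "outer_product a (axis x 1) *v h = h $ x *\<^sub>R a" for a :: "real ^ 'v" and x
    by (simp add: axis_def if_distrib[of "\<lambda>y. y * _"] cong: if_cong)
  show ?thesis
    unfolding perturbation_def
    by (simp add: matrix_vector_mult_add_rdistrib scaleR_matrix_vector_assoc[symmetric] op algebra_simps)
qed

lemma exp_add_odd_pi: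
  assumes "odd n"
  shows "exp (\<i> * of_real (a + of_int n * pi)) = - exp (\<i> * of_real a)"
proof -
  obtain m where n: "n = 2 * m + 1" using assms by (elim oddE)
  have "exp (\<i> * of_real (a + of_int n * pi)) = exp (\<i> * of_real a) * exp (\<i> * (of_int m * (of_real pi * 2))) * exp (of_real pi * \<i>)"
    unfolding exp_add[symmetric] by (rule arg_cong[where f = exp]) (simp add: n algebra_simps)
  then show ?thesis by simp
qed

lemma exp_add_even_pi:
  "exp (\<i> * of_real (a + of_int n * (2 * pi))) = exp (\<i> * of_real a)"
proof -
  have "exp (\<i> * of_real (a + of_int n * (2 * pi))) = exp (\<i> * of_real a) * exp (\<i> * (of_int n * (of_real pi * 2)))"
    unfolding exp_add[symmetric] by (rule arg_cong[where f = exp]) (simp add: algebra_simps)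
  then show ?thesis by simp
qed

text \<open>
  The equation \<open>square\<close> is the quadratic relation of a strongly regular graph with restricted
  eigenvalues \<open>\<theta>\<close> and \<open>\<tau>\<close>; a multiple of the all-ones matrix accounts for the valency \<open>k\<close>, which is
  the eigenvalue on constant vectors.
\<close>

locale perturbed_pair =
  fixes A :: "real ^ 'v ^ 'v" and u v :: 'v and \<theta> \<tau> k c :: real
  assumes distinct: "u \<noteq> v"
    and entries: "A $ u $ u = 0" "A $ u $ v = 0" "A $ v $ u = 0" "A $ v $ v = 0"
    and square: "A ** A = (\<theta> + \<tau>) *\<^sub>R A - (\<theta> * \<tau>) *\<^sub>R mat 1 + (\<chi> x y. c)"
    and row_sum: "\<And>x. (\<Sum>y\<in>UNIV. A $ x $ y) = k"
begin

abbreviation "M \<beta> \<equiv> perturbation A u v \<beta> (- \<beta>)"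
definition pair_sum :: "real ^ 'v" where "pair_sum = axis u 1 + axis v 1"
definition pair_diff :: "real ^ 'v" where "pair_diff = axis u 1 - axis v 1"

lemma M_mult: "M \<beta> *v h = A *v h - (\<beta> * (h $ u - h $ v)) *\<^sub>R pair_diff"
  unfolding pair_diff_def by (rule perturbation_mult_vec)

lemma A_square_vec:
  assumes "(\<Sum>x\<in>UNIV. h $ x) = 0"
  shows "A *v (A *v h) = (\<theta> + \<tau>) *\<^sub>R (A *v h) - (\<theta> * \<tau>) *\<^sub>R h"
proof -
  have "(\<chi> x y. c) *v h = 0"
    using assms by (simp add: vec_eq_iff matrix_vector_mult_def sum_distrib_left[symmetric])
  then show ?thesis
    by (simp add: matrix_vector_mul_assoc square matrix_vector_mult_add_rdistrib
      matrix_vector_mult_diff_rdistrib scaleR_matrix_vector_assoc[symmetric])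
qed

lemma A_entries: "(A *v pair_sum) $ u = 0" "(A *v pair_sum) $ v = 0" "(A *v pair_diff) $ u = 0" "(A *v pair_diff) $ v = 0"
  using distinct
  by (simp_all add: pair_sum_def pair_diff_def matrix_vector_right_distrib matrix_vector_mult_diff_distrib
    matrix_vector_mult_basis column_def entries)

lemma pair_sum_entries: "pair_sum $ u = 1" "pair_sum $ v = 1" and pair_diff_entries: "pair_diff $ u = 1" "pair_diff $ v = - 1"
  using distinct by (simp_all add: pair_sum_def pair_diff_def axis_def)

lemma sum_pair_sum: "(\<Sum>x\<in>UNIV. pair_sum $ x) = 2" and sum_pair_diff: "(\<Sum>x\<in>UNIV. pair_diff $ x) = 0"
  by (simp_all add: pair_sum_def pair_diff_def axis_def sum.distrib sum_subtractf)

lemma A_const: "A *v (\<chi> x. a) = k *\<^sub>R (\<chi> x. a)"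
  by (simp add: vec_eq_iff matrix_vector_mult_def sum_distrib_right[symmetric] row_sum)

text \<open>
  After removing its constant component \<open>j\<close>, the vector \<open>e\<^sub>u + e\<^sub>v\<close> generates a space on which
  \<open>M\<close> acts as \<open>A\<close>: every vector there takes equal values at \<open>u\<close> and \<open>v\<close>, which makes the
  rank one term vanish.
\<close>

lemma transition_symmetric:
  assumes ne: "\<theta> \<noteq> \<tau>" and ev: "exp (\<i> * of_real (t * \<theta>)) = \<rho>" "exp (\<i> * of_real (t * \<tau>)) = \<rho>"
    "exp (\<i> * of_real (t * k)) = \<rho>"
  shows "transition_matrix (M \<beta>) t *v complex_vec pair_sum = \<rho> *s complex_vec pair_sum"
proof -
  define a where "a = 2 / real CARD('v)"
  define j :: "real ^ 'v" where "j = (\<chi> x. a)"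
  define g where "g = pair_sum - j"
  have Aj: "A *v j = k *\<^sub>R j" unfolding j_def by (rule A_const)
  have "(\<Sum>x\<in>UNIV. g $ x) = 0"
    by (simp add: g_def j_def sum_subtractf sum_pair_sum a_def)
  note quad = A_square_vec[OF this]
  have Ag: "(A *v g) $ u = (A *v g) $ v"
    by (simp add: g_def matrix_vector_mult_diff_distrib A_entries Aj) (simp add: j_def)
  have Mg: "M \<beta> *v g = A *v g" and MAg: "M \<beta> *v (A *v g) = A *v (A *v g)"
    by (simp_all add: M_mult Ag) (simp add: g_def pair_sum_entries j_def)
  have 1: "transition_matrix (M \<beta>) t *v complex_vec g = \<rho> *s complex_vec g"
    by (rule transition_matrix_two_eigenvalues[OF _ ne ev(1,2)]) (simp only: Mg MAg quad)
  have "M \<beta> *v j = k *\<^sub>R j" by (simp add: M_mult Aj) (simp add: j_def)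
  from transition_matrix_eigenvector[OF this, of t]
  have 2: "transition_matrix (M \<beta>) t *v complex_vec j = \<rho> *s complex_vec j" by (simp only: ev)
  have "pair_sum = g + j" by (simp add: g_def)
  then show ?thesis
    by (simp add: complex_vec_lincomb matrix_vector_right_distrib 1 2 vector_add_ldistrib)
qed

text \<open>
  On the span of \<open>w = e\<^sub>u - e\<^sub>v\<close> and \<open>A w\<close> one has \<open>M w = A w - 2 \<beta> w\<close>, and \<open>M (A w) = A (A w)\<close>
  because \<open>A w\<close> vanishes at \<open>u\<close> and \<open>v\<close>. The two hypotheses on \<open>\<mu>\<close> and \<open>\<nu>\<close> prescribe the trace and
  the determinant of this action.
\<close>

lemma transition_alternating:
  assumes sum: "\<mu> + \<nu> = \<theta> + \<tau> - 2 * \<beta>" and prod: "\<mu> * \<nu> = \<theta> * \<tau> - 2 * \<beta> * (\<theta> + \<tau>)"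
    and ne: "\<mu> \<noteq> \<nu>" and ev: "exp (\<i> * of_real (t * \<mu>)) = \<rho>" "exp (\<i> * of_real (t * \<nu>)) = \<rho>"
  shows "transition_matrix (M \<beta>) t *v complex_vec pair_diff = \<rho> *s complex_vec pair_diff"
proof (rule transition_matrix_two_eigenvalues[OF _ ne ev])
  have Mw: "M \<beta> *v pair_diff = A *v pair_diff - (2 * \<beta>) *\<^sub>R pair_diff"
    by (simp add: M_mult pair_diff_entries)
  have MAw: "M \<beta> *v (A *v pair_diff) = (\<theta> + \<tau>) *\<^sub>R (A *v pair_diff) - (\<theta> * \<tau>) *\<^sub>R pair_diff"
    by (simp add: M_mult A_entries A_square_vec[OF sum_pair_diff])
  show "M \<beta> *v (M \<beta> *v pair_diff) = (\<mu> + \<nu>) *\<^sub>R (M \<beta> *v pair_diff) - (\<mu> * \<nu>) *\<^sub>R pair_diff"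
    unfolding Mw matrix_vector_mult_diff_distrib matrix_vector_mult_scaleR MAw sum prod
    by (simp add: vec_eq_iff algebra_simps)
qed

lemma perfect_state_transfer_sum:
  assumes "t > 0" "cmod \<rho> = 1"
    "transition_matrix (M \<beta>) t *v complex_vec pair_sum = \<rho> *s complex_vec pair_sum"
    "transition_matrix (M \<beta>) t *v complex_vec pair_diff = (- \<rho>) *s complex_vec pair_diff"
  shows "perfect_state_transfer (M \<beta>) u v"
  using perfect_state_transferI[of t \<rho> "M \<beta>" u v] assms unfolding pair_sum_def pair_diff_def by blast

text \<open>
  The phases are arranged by the time \<open>2 \<pi> r / d\<close>: a shift of the eigenvalue by \<open>d\<close> changes
  the phase by a multiple of \<open>2 \<pi>\<close>, and a shift by \<open>d a / (2 r)\<close> with \<open>a\<close> odd reverses its sign.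
  The shifts of \<open>\<mu>\<close> and \<open>\<nu>\<close> from \<open>\<theta>\<close> are \<open>d a / (2 r)\<close> with \<open>a = 3 \<tau>'\<close> and \<open>a = r\<close>; the
  trace condition then determines \<open>\<beta>\<close>, and the determinant condition holds by the choice
  \<open>r = 2 D' - \<tau>'\<close>.
\<close>

lemma perfect_state_transfer_2_adic:
  fixes D' \<tau>' n :: int
  assumes D: "\<theta> - \<tau> = 4 * b * of_int D'" and tau: "\<tau> = b * of_int \<tau>'" and b: "b > 0"
    and D': "D' > 0" and tau': "odd \<tau>'" "\<tau>' < 0"
    and k: "k = \<theta> + (\<theta> - \<tau>) * of_int n"
    and rat: "b \<in> \<rat>"
  shows "\<exists>\<beta>\<in>\<rat>. perfect_state_transfer (M \<beta>) u v"
proof -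
  define d where "d = \<theta> - \<tau>"
  define r where "r = 2 * D' - \<tau>'"
  have r: "odd r" "r > 0" using tau' D' by (auto simp: r_def)
  have d: "d > 0" using D b D' by (simp add: d_def)
  define \<mu> where "\<mu> = \<theta> + 3 * \<tau>' * d / (2 * r)"
  define \<nu> where "\<nu> = \<theta> + d / 2"
  define \<beta> where "\<beta> = - (3 * d * D') / (2 * r)"
  define t where "t = 2 * pi * r / d"
  define \<rho> where "\<rho> = exp (\<i> * of_real (t * \<theta>))"
  have "d \<in> \<rat>" unfolding d_def D using rat by simp
  then have "\<beta> \<in> \<rat>" by (simp add: \<beta>_def)
  moreover have "perfect_state_transfer (M \<beta>) u v"
  proof (rule perfect_state_transfer_sum)
    show "t > 0" using r d by (simp add: t_def)
    show "cmod \<rho> = 1" unfolding \<rho>_def by (rule norm_exp_i_times)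
    have "t * \<tau> = t * \<theta> + of_int (- r) * (2 * pi)"
      using d by (simp add: t_def field_simps) (simp add: d_def algebra_simps)
    then have e1: "exp (\<i> * of_real (t * \<tau>)) = \<rho>" unfolding \<rho>_def by (simp only: exp_add_even_pi)
    have "t * k = t * \<theta> + of_int (r * n) * (2 * pi)"
      using d by (simp add: t_def k d_def[symmetric] field_simps)
    then have e2: "exp (\<i> * of_real (t * k)) = \<rho>" unfolding \<rho>_def by (simp only: exp_add_even_pi)
    show "transition_matrix (M \<beta>) t *v complex_vec pair_sum = \<rho> *s complex_vec pair_sum"
      by (rule transition_symmetric) (use d e1 e2 in \<open>auto simp: d_def \<rho>_def\<close>)
    have r0: "real_of_int r \<noteq> 0" using r by simp
    have "t * \<mu> = t * \<theta> + of_int (3 * \<tau>') * pi"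
      using d r0 by (simp add: t_def \<mu>_def field_simps)
    then have e3: "exp (\<i> * of_real (t * \<mu>)) = - \<rho>"
      unfolding \<rho>_def using tau' by (subst exp_add_odd_pi[symmetric, of "3 * \<tau>'"]) simp_all
    have "t * \<nu> = t * \<theta> + of_int r * pi"
      using d by (simp add: t_def \<nu>_def field_simps)
    then have e4: "exp (\<i> * of_real (t * \<nu>)) = - \<rho>"
      unfolding \<rho>_def by (simp only: exp_add_odd_pi[OF r(1)])
    have rr: "real_of_int r = 2 * of_int D' - of_int \<tau>'" by (simp add: r_def)
    have th: "\<theta> = \<tau> + d" by (simp add: d_def)
    have dd: "d = 4 * b * of_int D'" using D by (simp add: d_def)
    show "transition_matrix (M \<beta>) t *v complex_vec pair_diff = (- \<rho>) *s complex_vec pair_diff"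
    proof (rule transition_alternating[OF _ _ _ e3 e4])
      show "\<mu> + \<nu> = \<theta> + \<tau> - 2 * \<beta>"
        using r0 unfolding \<mu>_def \<nu>_def \<beta>_def th by (simp add: field_simps) (simp add: rr algebra_simps)
      show "\<mu> * \<nu> = \<theta> * \<tau> - 2 * \<beta> * (\<theta> + \<tau>)"
        using r0 unfolding \<mu>_def \<nu>_def \<beta>_def th by (simp add: field_simps)
          (simp add: rr dd tau algebra_simps power2_eq_square)
      have "3 * \<tau>' * d / (2 * r) < 0" using tau' d r by (intro divide_neg_pos mult_neg_pos) auto
      then have "\<mu> < \<nu>" using d unfolding \<mu>_def \<nu>_def by linarith
      then show "\<mu> \<noteq> \<nu>" by simp
    qed
  qed
  ultimately show ?thesis by blast
qed

lemma perfect_state_transfer_edgeless: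
  assumes "A = 0"
  shows "perfect_state_transfer (M 1) u v"
proof (rule perfect_state_transfer_sum[of "pi / 2" 1])
  have "M 1 *v pair_sum = 0 *\<^sub>R pair_sum" "M 1 *v pair_diff = (- 2) *\<^sub>R pair_diff"
    unfolding M_mult by (simp_all add: assms pair_sum_entries pair_diff_entries)
  note ev = this[THEN transition_matrix_eigenvector, of "pi / 2"]
  show "transition_matrix (M 1) (pi / 2) *v complex_vec pair_sum = 1 *s complex_vec pair_sum"
    using ev(1) by simp
  show "transition_matrix (M 1) (pi / 2) *v complex_vec pair_diff = (- 1) *s complex_vec pair_diff"
    using ev(2) exp_add_odd_pi[of "- 1" 0] by simp
qed simp_all

text \<open>
  With four vertices and valency two, \<open>u\<close> and \<open>v\<close> are both adjacent to the two remaining vertices.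
  Hence \<open>A\<close> annihilates \<open>e\<^sub>u - e\<^sub>v\<close>, and its square acts on \<open>e\<^sub>u + e\<^sub>v\<close> as the scalar 4. The
  restricted eigenvalue 0 does not occur in \<open>e\<^sub>u + e\<^sub>v\<close>, which is why time \<open>\<pi> / 2\<close> is possible although
  the phases of 0 and 2 differ there.
\<close>

lemma perfect_state_transfer_four_cycle:
  assumes card: "CARD('v) = 4" and k: "k = 2"
    and le: "\<And>x y. A $ x $ y \<le> 1" and sym: "\<And>x y. A $ x $ y = A $ y $ x"
  shows "perfect_state_transfer (M 0) u v"
proof -
  have one: "A $ z $ x = 1" if z: "z \<in> {u, v}" and x: "x \<notin> {u, v}" for x z
  proof -
    have "(\<Sum>y\<in>UNIV. 1 - A $ z $ y) = 2"
      using card k by (simp add: sum_subtractf row_sum)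
    moreover have "(\<Sum>y\<in>UNIV. 1 - A $ z $ y)
        = (\<Sum>y\<in>UNIV - {u, v}. 1 - A $ z $ y) + (\<Sum>y\<in>{u, v}. 1 - A $ z $ y)"
      by (rule sum.subset_diff) auto
    moreover have "(\<Sum>y\<in>{u, v}. 1 - A $ z $ y) = 2"
      using z distinct entries by auto
    ultimately have "(\<Sum>y\<in>UNIV - {u, v}. 1 - A $ z $ y) = 0" by simp
    then have "\<forall>y\<in>UNIV - {u, v}. 1 - A $ z $ y = 0"
      by (subst (asm) sum_nonneg_eq_0_iff) (simp_all add: le)
    then show ?thesis using x by simp
  qed
  have col: "(A *v axis z 1) $ x = (if x \<in> {u, v} then 0 else 1)" if "z \<in> {u, v}" for x z
    using that one[OF that, of x] entries
    by (auto simp: matrix_vector_mult_basis column_def sym[of x])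
  have "(A *v pair_sum) $ x = 2 * (1 - pair_sum $ x)" "(A *v pair_diff) $ x = 0" for x
  proof -
    have "pair_sum $ x = (if x \<in> {u, v} then 1 else 0)" using distinct by (auto simp: pair_sum_def axis_def)
    then show "(A *v pair_sum) $ x = 2 * (1 - pair_sum $ x)" "(A *v pair_diff) $ x = 0"
      by (auto simp: pair_sum_def pair_diff_def matrix_vector_right_distrib matrix_vector_mult_diff_distrib col)
  qed
  then have Af: "A *v pair_sum = 2 *\<^sub>R ((\<chi> x. 1) - pair_sum)" and Aw: "A *v pair_diff = 0"
    by (simp_all add: vec_eq_iff)
  have "M 0 *v (M 0 *v pair_sum) = (2 + - 2) *\<^sub>R (M 0 *v pair_sum) - (2 * - 2) *\<^sub>R pair_sum"
  proof -
    have M0: "M 0 *v h = A *v h" for h unfolding M_mult by simp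
    show ?thesis
      unfolding M0 Af matrix_vector_mult_scaleR matrix_vector_mult_diff_distrib A_const k
      by (simp add: vec_eq_iff)
  qed
  from transition_matrix_two_eigenvalues[OF this, of "pi / 2" "- 1"]
  have Uf: "transition_matrix (M 0) (pi / 2) *v complex_vec pair_sum = (- 1) *s complex_vec pair_sum"
    using exp_add_odd_pi[of "- 1" 0] exp_add_odd_pi[of 1 0] by simp
  have "M 0 *v pair_diff = 0 *\<^sub>R pair_diff" unfolding M_mult Aw by simp
  from transition_matrix_eigenvector[OF this, of "pi / 2"]
  have Uw: "transition_matrix (M 0) (pi / 2) *v complex_vec pair_diff = (- (- 1)) *s complex_vec pair_diff" by simp
  show ?thesis by (rule perfect_state_transfer_sum[OF _ _ Uf Uw]) simp_all
qed

end

section \<open>Finite fields of even order\<close>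

text \<open>
  The product of all nonzero elements is unchanged by negating each of its factors. Their number is
  odd, so \<open>- 1 = 1\<close>.
\<close>

lemma even_field_double:
  fixes x :: "'a::{field,finite}"
  assumes "even CARD('a)"
  shows "x + x = 0"
proof -
  let ?S = "UNIV - {0::'a}"
  have bij: "bij_betw uminus ?S ?S"
    by (rule bij_betwI[where g = uminus]) auto
  have "(\<Prod>y\<in>?S. y) = (\<Prod>y\<in>?S. - y)"
    using prod.reindex_bij_betw[OF bij, of "\<lambda>y. y"] by simp
  also have "\<dots> = (- 1) ^ card ?S * (\<Prod>y\<in>?S. y)"
    by (simp add: prod_uminus)
  finally have "(- 1 :: 'a) ^ card ?S = 1" by simp
  moreover have "odd (card ?S)"
    using assms by (simp add: card_Diff_singleton)
  ultimately have "(-1::'a) = 1" by simp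
  then have "(1::'a) + 1 = 0" by (metis add.right_inverse)
  then show ?thesis by (metis distrib_left mult.right_neutral mult_zero_right)
qed

lemma even_field_square_bij:
  assumes ev: "even CARD('a::{field,finite})"
  shows "bij (\<lambda>x::'a. x\<^sup>2)"
proof -
  have "inj (\<lambda>x::'a. x\<^sup>2)"
  proof (rule injI)
    fix x y :: 'a assume "x\<^sup>2 = y\<^sup>2"
    then consider "x = y" | "x = - y" by (auto simp: power2_eq_iff)
    moreover have "- y = y" using even_field_double[OF ev, of y] by (simp add: eq_neg_iff_add_eq_0)
    ultimately show "x = y" by auto
  qed
  then show ?thesis by (simp add: finite_UNIV_inj_surj bij_def)
qed

text \<open>
  In characteristic two every element is its own negative, so these sets are the additive subgroups.
\<close>

definition closed_add :: "'a::monoid_add set \<Rightarrow> bool" where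
  "closed_add H \<longleftrightarrow> 0 \<in> H \<and> (\<forall>x\<in>H. \<forall>y\<in>H. x + y \<in> H)"

text \<open>
  Adjoining one element doubles a subgroup. Subgroups maximal for a suitable property can
  therefore replace a basis over the prime field, both for the order of the field and for the construction
  of a character.
\<close>

lemma closed_add_extend:
  fixes a :: "'a::{field,finite}"
  assumes ev: "even CARD('a)" and H: "closed_add H" and a: "a \<notin> H"
  shows "closed_add (H \<union> (+) a ` H)" "card (H \<union> (+) a ` H) = 2 * card H"
proof -
  have aa: "a + (a + z) = z" for z
    using even_field_double[OF ev, of a] by (simp add: add.assoc[symmetric])
  have mem: "z \<in> H \<union> (+) a ` H \<longleftrightarrow> z \<in> H \<or> a + z \<in> H" for z
    using aa by force
  show "closed_add (H \<union> (+) a ` H)"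
    unfolding closed_add_def mem
  proof (intro conjI ballI)
    show "0 \<in> H \<or> a + 0 \<in> H" using H by (simp add: closed_add_def)
    fix x y assume "x \<in> H \<union> (+) a ` H" "y \<in> H \<union> (+) a ` H"
    then have "x \<in> H \<or> a + x \<in> H" "y \<in> H \<or> a + y \<in> H" by (simp_all only: mem)
    moreover have "(a + x) + y = a + (x + y)" "x + (a + y) = a + (x + y)"
      "(a + x) + (a + y) = x + y"
      using aa[of "x + y"] by (simp_all add: algebra_simps)
    ultimately show "x + y \<in> H \<or> a + (x + y) \<in> H"
      using H unfolding closed_add_def by metis
  qed
  have "H \<inter> (+) a ` H = {}"
  proof (rule ccontr)
    assume "H \<inter> (+) a ` H \<noteq> {}"
    then obtain h where h: "h \<in> H" "a + h \<in> H" by auto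
    then have "h + (a + h) \<in> H" using H unfolding closed_add_def by blast
    moreover have "h + (a + h) = a"
      using even_field_double[OF ev, of h] by (simp add: add.left_commute[of h a])
    ultimately show False using a by simp
  qed
  then show "card (H \<union> (+) a ` H) = 2 * card H"
    by (subst card_Un_disjoint) (auto simp: card_image)
qed

lemma even_field_card_power_of_two:
  assumes ev: "even CARD('a::{field,finite})"
  shows "\<exists>m. CARD('a) = 2 ^ m"
proof -
  let ?P = "\<lambda>H::'a set. closed_add H \<and> (\<exists>m. card H = 2 ^ m)"
  have "?P {0}" by (auto simp: closed_add_def intro: exI[of _ 0])
  then have "Collect ?P \<noteq> {}" by blast
  from finite_has_maximal[OF finite this]
  obtain H where H: "?P H" and max: "\<And>K. ?P K \<Longrightarrow> H \<subseteq> K \<Longrightarrow> H = K" by blast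
  have "a \<in> H" for a
  proof (rule ccontr)
    assume a: "a \<notin> H"
    from H obtain m where m: "card H = 2 ^ m" by blast
    have "?P (H \<union> (+) a ` H)"
      using closed_add_extend[OF ev _ a] H m by (auto intro: exI[of _ "Suc m"])
    then have "H = H \<union> (+) a ` H" using max by blast
    moreover have "a \<in> (+) a ` H" using H by (force simp: closed_add_def)
    ultimately show False using a by blast
  qed
  then have "H = UNIV" by blast
  then show ?thesis using H by blast
qed

text \<open>
  A subgroup \<open>H\<close> maximal among those not containing 1 has index two: for \<open>x\<close> outside \<open>H\<close> the
  extension by \<open>x\<close> contains 1, which forces \<open>x + 1 \<in> H\<close>. The character is the sign of
  membership in \<open>H\<close>.
\<close>

lemma even_field_additive_character:
  assumes ev: "even CARD('a::{field,finite})"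
  shows "\<exists>\<psi> :: 'a \<Rightarrow> real. (\<forall>x y. \<psi> (x + y) = \<psi> x * \<psi> y) \<and> \<psi> 1 = - 1"
proof -
  let ?P = "\<lambda>H::'a set. closed_add H \<and> 1 \<notin> H"
  have "?P {0}" by (auto simp: closed_add_def)
  then have "Collect ?P \<noteq> {}" by blast
  from finite_has_maximal[OF finite this]
  obtain H where H: "closed_add H" "1 \<notin> H"
    and max: "\<And>K. ?P K \<Longrightarrow> H \<subseteq> K \<Longrightarrow> H = K" by blast
  have dbl: "z + z = 0" for z :: 'a by (rule even_field_double[OF ev])
  have add: "x + y \<in> H" if "x \<in> H" "y \<in> H" for x y using H(1) that by (simp add: closed_add_def)
  have compl: "x + 1 \<in> H" if x: "x \<notin> H" for x
  proof -
    have "1 \<in> H \<union> (+) x ` H"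
    proof (rule ccontr)
      assume "1 \<notin> H \<union> (+) x ` H"
      then have "H = H \<union> (+) x ` H"
        using max[of "H \<union> (+) x ` H"] closed_add_extend[OF ev H(1) x] by blast
      moreover have "x \<in> (+) x ` H" using H(1) by (force simp: closed_add_def)
      ultimately show False using x by blast
    qed
    then obtain h where h: "h \<in> H" "1 = x + h" using H(2) by auto
    have "x + 1 = (x + x) + h" using h(2) by (simp only: add.assoc)
    then have "x + 1 = h" by (simp only: dbl add_0)
    then show ?thesis using h(1) by simp
  qed
  have mix: "x + y \<notin> H" if "x \<in> H" "y \<notin> H" for x y
  proof
    assume "x + y \<in> H"
    then have "x + (x + y) \<in> H" using add that by blast
    then show False using that dbl[of x] by (simp add: add.assoc[symmetric])
  qed
  have out: "x + y \<in> H" if "x \<notin> H" "y \<notin> H" for x y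
  proof -
    have "(x + 1) + (y + 1) \<in> H" using add compl that by blast
    moreover have "(x + 1) + (y + 1) = x + y" using dbl[of 1] by (simp add: algebra_simps)
    ultimately show ?thesis by simp
  qed
  show ?thesis
  proof (intro exI[of _ "\<lambda>x. if x \<in> H then 1 else - 1"] conjI allI)
    fix x y :: 'a
    show "(if x + y \<in> H then 1 else - 1 :: real) =
      (if x \<in> H then 1 else - 1) * (if y \<in> H then 1 else - 1)"
      using add[of x y] mix[of x y] mix[of y x] out[of x y] by (auto simp: add.commute)
  qed (use H(2) in simp)
qed

section \<open>Subspaces\<close>

lemma card_vec_span:
  fixes B :: "('a::{field,finite} ^ 'n) set"
  assumes "vec.independent B"
  shows "card (vec.span B) = CARD('a) ^ card B"
proof -
  have "finite B" by simp
  then show ?thesis using assms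
  proof (induction B rule: finite_induct)
    case empty
    then show ?case by simp
  next
    case (insert b B)
    have ind: "vec.independent B" and b: "b \<notin> vec.span B"
      using insert.prems insert.hyps by (auto simp: vec.independent_insert)
    have "bij_betw (\<lambda>(k, x). k *s b + x) (UNIV \<times> vec.span B) (vec.span (insert b B))"
      unfolding bij_betw_def
    proof
      show "inj_on (\<lambda>(k, x). k *s b + x) (UNIV \<times> vec.span B)"
      proof (rule inj_onI, clarsimp)
        fix k x l y assume x: "x \<in> vec.span B" and y: "y \<in> vec.span B"
          and eq: "k *s b + x = l *s b + y"
        then have *: "(k - l) *s b = y - x" by (simp add: algebra_simps vec.scale_left_diff_distrib)
        then have "(k - l) *s b \<in> vec.span B" using x y by (simp add: vec.span_diff)
        then have "k = l" using b vec.span_scale[of "(k - l) *s b" B "inverse (k - l)"]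
          by (cases "k = l") (simp_all only: vec.scale_scale, simp_all)
        then show "k = l \<and> x = y" using eq by simp
      qed
      show "(\<lambda>(k, x). k *s b + x) ` (UNIV \<times> vec.span B) = vec.span (insert b B)"
      proof (intro equalityI subsetI)
        fix z assume "z \<in> (\<lambda>(k, x). k *s b + x) ` (UNIV \<times> vec.span B)"
        then show "z \<in> vec.span (insert b B)"
          unfolding vec.span_insert by (clarsimp, metis add_diff_cancel_left')
      next
        fix z assume "z \<in> vec.span (insert b B)"
        then obtain k where "z - k *s b \<in> vec.span B" by (auto simp: vec.span_insert)
        then show "z \<in> (\<lambda>(k, x). k *s b + x) ` (UNIV \<times> vec.span B)"
          by (intro image_eqI[of _ _ "(k, z - k *s b)"]) auto
      qed
    qed
    then have "card (vec.span (insert b B)) = CARD('a) * card (vec.span B)"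
      by (metis bij_betw_same_card card_cartesian_product)
    then show ?case using insert.IH[OF ind] insert.hyps by simp
  qed
qed

lemma card_vec_subspace:
  fixes W :: "('a::{field,finite} ^ 'n) set"
  assumes "vec.subspace W"
  shows "card W = CARD('a) ^ vec.dim W"
proof -
  obtain B where "B \<subseteq> W" "vec.independent B" "W \<subseteq> vec.span B" "card B = vec.dim W"
    using vec.basis_exists by blast
  moreover then have "vec.span B = W" using assms by (meson vec.span_minimal subset_antisym)
  ultimately show ?thesis using card_vec_span by metis
qed

section \<open>Gauss sums of quadratic forms in even characteristic\<close>

text \<open>
  All orthogonality relations below come from a translation that reverses the sign of the
  summand.
\<close>

lemma sum_translation_cancel:
  fixes h :: "'b::ab_group_add \<Rightarrow> real"
  assumes z: "z + z = 0" and S: "\<And>x. x \<in> S \<Longrightarrow> x + z \<in> S"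
    and h: "\<And>x. x \<in> S \<Longrightarrow> h (x + z) = - h x"
  shows "sum h S = 0"
proof -
  have "sum h S = (\<Sum>x\<in>S. h (x + z))"
    by (rule sum.reindex_bij_witness[of _ "\<lambda>x. x + z" "\<lambda>x. x + z"]) (simp_all add: S z add.assoc)
  also have "\<dots> = - sum h S" by (simp add: h sum_negf)
  finally show ?thesis by simp
qed

text \<open>
  The orders of the field and of the space enter as real parameters because all character sums are
  real numbers.
\<close>

locale even_quadratic_form =
  fixes Q :: "'a::{field,finite} ^ 'n \<Rightarrow> 'a" and \<psi> :: "'a \<Rightarrow> real" and q N :: real
  assumes even: "even CARD('a)"
    and q_eq: "q = real CARD('a)"
    and N_eq: "N = q ^ CARD('n)"
    and quad: "quadratic_form Q"
    and nondeg: "nondegenerate_form Q"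
    and psi_add: "\<psi> (x + y) = \<psi> x * \<psi> y"
    and psi_one: "\<psi> 1 = - 1"
begin

abbreviation "B \<equiv> polar_form Q"

lemma card_field [simp]: "real CARD('a) = q" and card_space [simp]: "q ^ CARD('n) = N"
  by (simp_all add: q_eq N_eq)

definition gauss :: real where "gauss = (\<Sum>x\<in>UNIV. \<psi> (Q x))"

definition perp :: "('a ^ 'n) set \<Rightarrow> ('a ^ 'n) set" where
  "perp W = {x. \<forall>w\<in>W. B x w = 0}"

lemma double [simp]: "x + x = (0::'a)" and double_vec [simp]: "v + v = (0::'a ^ 'n)"
  by (simp_all only: even_field_double[OF even] vec_eq_iff vector_add_component zero_index simp_thms)

lemma double_left [simp]: "v + (v + w) = (w::'a ^ 'n)"
  by (simp add: add.assoc[symmetric])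

lemma diff_eq_add: "v - w = v + (w::'a ^ 'n)"
  by (simp add: diff_eq_eq add.assoc)

lemma Q_scale: "Q (c *s x) = c\<^sup>2 * Q x"
  using quad by (simp add: quadratic_form_def)

lemma Q_zero [simp]: "Q 0 = 0"
  using Q_scale[of 0 0] by simp

lemma Q_add: "Q (x + y) = Q x + Q y + B x y"
  by (simp add: polar_form_def)

lemma B_commute: "B x y = B y x"
  by (simp add: polar_form_def add.commute)

lemma B_right: "B x (y + z) = B x y + B x z" "B x (c *s y) = c * B x y" "B x 0 = 0"
proof -
  have "Vector_Spaces.linear (*s) (*) (B x)" using quad by (simp add: quadratic_form_def)
  then interpret l: Vector_Spaces.linear "(*s)" "(*)" "B x" .
  show "B x (y + z) = B x y + B x z" "B x (c *s y) = c * B x y" "B x 0 = 0"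
    by (rule l.add, rule l.scale, rule l.zero)
qed

lemma B_left: "B (y + z) x = B y x + B z x" "B (c *s y) x = c * B y x" "B 0 x = 0"
  using B_right by (simp_all add: B_commute[of _ x])

lemma psi_zero [simp]: "\<psi> 0 = 1"
  using psi_add[of 1 0] psi_one by simp

lemma psi_square [simp]: "\<psi> x * \<psi> x = 1"
  using psi_add[of x x] by simp

lemma sum_psi_multiples: "(\<Sum>a\<in>UNIV. \<psi> (a * c)) = (if c = 0 then q else 0)"
proof (cases "c = 0")
  case False
  then have "(\<Sum>a\<in>UNIV. \<psi> (a * c)) = 0"
    by (intro sum_translation_cancel[of "inverse c"]) (simp_all add: distrib_right psi_add psi_one)
  then show ?thesis using False by simp
qed simp

lemma sum_psi_polar:
  assumes W: "vec.subspace W"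
  shows "(\<Sum>w\<in>W. \<psi> (B x w)) = (if x \<in> perp W then real (card W) else 0)"
proof (cases "x \<in> perp W")
  case True
  then show ?thesis by (simp add: perp_def)
next
  case False
  then obtain w where w: "w \<in> W" "B x w \<noteq> 0" by (auto simp: perp_def)
  let ?z = "inverse (B x w) *s w"
  have "B x ?z = 1" "?z \<in> W" using w W by (simp_all add: B_right vec.subspace_scale)
  then have "(\<Sum>w\<in>W. \<psi> (B x w)) = 0"
    by (intro sum_translation_cancel[of ?z])
      (simp_all add: B_right psi_add psi_one vec.subspace_add[OF W])
  then show ?thesis using False by simp
qed

text \<open>
  Count the pairs \<open>(x, w)\<close> weighted by \<open>\<psi> (B x w)\<close> in two ways. A vector \<open>w\<close> of \<open>W\<close> that is
  orthogonal to everything is singular as well, hence zero by nondegeneracy; so the usual formula holds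
  before the polar form is known to be nondegenerate.
\<close>

lemma card_perp:
  assumes W: "totally_singular Q W"
  shows "real (card W) * real (card (perp W)) = N"
proof -
  have sub: "vec.subspace W" using W by (simp add: totally_singular_def)
  have rad: "w \<in> perp UNIV \<longleftrightarrow> w = 0" if "w \<in> W" for w
    using nondeg W that B_left
    by (auto simp: nondegenerate_form_def totally_singular_def perp_def)
  have "real (card W) * real (card (perp W)) = (\<Sum>x\<in>UNIV. if x \<in> perp W then real (card W) else 0)"
    by (simp add: sum.If_cases mult.commute)
  also have "\<dots> = (\<Sum>x\<in>UNIV. \<Sum>w\<in>W. \<psi> (B x w))"
    by (simp only: sum_psi_polar[OF sub])
  also have "\<dots> = (\<Sum>w\<in>W. \<Sum>x\<in>UNIV. \<psi> (B w x))"
    by (subst sum.swap) (simp only: B_commute)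
  also have "\<dots> = (\<Sum>w\<in>W. if w = 0 then N else 0)"
    by (intro sum.cong refl) (simp add: sum_psi_polar rad)
  also have "\<dots> = N" using vec.subspace_0[OF sub] by (simp add: sum.delta')
  finally show ?thesis .
qed

text \<open>
  Average \<open>\<psi> (Q (x + w))\<close> over \<open>w\<close> in \<open>W\<close>. As \<open>Q (x + w) = Q x + B x w\<close>, the average vanishes
  unless \<open>x\<close> is orthogonal to \<open>W\<close>.
\<close>

lemma gauss_perp:
  assumes W: "totally_singular Q W"
  shows "gauss = (\<Sum>x\<in>perp W. \<psi> (Q x))"
proof -
  have sub: "vec.subspace W" and Q0: "\<And>w. w \<in> W \<Longrightarrow> Q w = 0"
    using W by (auto simp: totally_singular_def)
  have pos: "real (card W) \<noteq> 0"
    using vec.subspace_0[OF sub] by auto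
  have "real (card W) * gauss = (\<Sum>w\<in>W. \<Sum>x\<in>UNIV. \<psi> (Q (x + w)))"
  proof -
    have "gauss = (\<Sum>x\<in>UNIV. \<psi> (Q (x + w)))" for w
      unfolding gauss_def
      by (rule sum.reindex_bij_witness[of _ "\<lambda>x. x + w" "\<lambda>x. x + w"]) (simp_all add: add.assoc)
    then show ?thesis by simp
  qed
  also have "\<dots> = (\<Sum>w\<in>W. \<Sum>x\<in>UNIV. \<psi> (Q x) * \<psi> (B x w))"
    by (intro sum.cong refl) (simp add: Q_add Q0 psi_add)
  also have "\<dots> = (\<Sum>x\<in>UNIV. \<psi> (Q x) * (\<Sum>w\<in>W. \<psi> (B x w)))"
    by (subst sum.swap) (simp only: sum_distrib_left)
  also have "\<dots> = (\<Sum>x\<in>UNIV. if x \<in> perp W then real (card W) * \<psi> (Q x) else 0)"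
    by (intro sum.cong refl) (simp add: sum_psi_polar[OF sub])
  also have "\<dots> = real (card W) * (\<Sum>x\<in>perp W. \<psi> (Q x))"
    by (simp add: sum.If_cases sum_distrib_left)
  finally show ?thesis using pos by (metis mult_left_cancel)
qed

lemma obtain_sqrt:
  fixes a :: 'a
  obtains b where "a = b\<^sup>2"
  using even_field_square_bij[OF even] unfolding bij_def surj_def by blast

text \<open>
  Every \<open>a\<close> is a square \<open>b\<^sup>2\<close>, and \<open>b\<^sup>2 Q x = Q (b x)\<close>. In even characteristic the sum is
  thus the same for all nontrivial characters of order two.
\<close>

lemma sum_psi_scaled:
  assumes S: "\<And>c x. x \<in> S \<Longrightarrow> c *s x \<in> S" and a: "a \<noteq> 0"
  shows "(\<Sum>x\<in>S. \<psi> (a * Q x)) = (\<Sum>x\<in>S. \<psi> (Q x))"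
proof -
  obtain b where b: "a = b\<^sup>2" by (rule obtain_sqrt)
  with a have "b \<noteq> 0" by auto
  then show ?thesis
    by (intro sum.reindex_bij_witness[of _ "\<lambda>x. inverse b *s x" "\<lambda>x. b *s x"])
      (simp_all add: S b Q_scale)
qed

text \<open>
  Orthogonality in \<open>a\<close> turns the sums of \<open>\<psi> (a Q x)\<close> over \<open>perp W\<close> into \<open>q\<close> times the number of
  singular vectors there, which is the order of \<open>W\<close>. The term \<open>a = 0\<close> contributes the order of
  \<open>perp W\<close> and each of the others contributes \<open>gauss\<close>.
\<close>

lemma gauss_value:
  assumes W: "totally_singular Q W" and max: "{x \<in> perp W. Q x = 0} = W"
  shows "(q - 1) * gauss = q * real (card W) - real (card (perp W))"
proof -
  have scale: "c *s x \<in> perp W" if "x \<in> perp W" for c x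
    using that by (simp add: perp_def B_left)
  have "q * real (card W) = (\<Sum>x\<in>perp W. if Q x = 0 then q else 0)"
    by (simp add: sum.If_cases max Int_def)
  also have "\<dots> = (\<Sum>x\<in>perp W. \<Sum>a\<in>UNIV. \<psi> (a * Q x))"
    by (simp only: sum_psi_multiples)
  also have "\<dots> = (\<Sum>a\<in>UNIV. \<Sum>x\<in>perp W. \<psi> (a * Q x))"
    by (rule sum.swap)
  also have "\<dots> = (\<Sum>x\<in>perp W. \<psi> (0 * Q x)) + (\<Sum>a\<in>UNIV - {0}. \<Sum>x\<in>perp W. \<psi> (a * Q x))"
    by (rule sum.remove) auto
  also have "(\<Sum>a\<in>UNIV - {0}. \<Sum>x\<in>perp W. \<psi> (a * Q x)) = (\<Sum>a\<in>UNIV - {0::'a}. gauss)"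
    unfolding gauss_perp[OF W] by (intro sum.cong refl sum_psi_scaled scale) auto
  also have "\<dots> = (q - 1) * gauss"
    by (simp add: card_Diff_singleton of_nat_diff)
  finally show ?thesis by simp
qed

text \<open>
  A singular vector orthogonal to \<open>W\<close> but outside it would extend \<open>W\<close> to a larger totally
  singular subspace.
\<close>

lemma obtain_maximal_totally_singular:
  obtains W where "totally_singular Q W" "vec.dim W = witt_index Q" "{x \<in> perp W. Q x = 0} = W"
proof -
  let ?S = "{vec.dim W | W. totally_singular Q W}"
  have "?S = vec.dim ` Collect (totally_singular Q)" by blast
  then have fin: "finite ?S" by simp
  have "totally_singular Q {0}" by (simp add: totally_singular_def)
  then have "?S \<noteq> {}" by blast
  from Max_in[OF fin this] obtain W where W: "totally_singular Q W" "vec.dim W = witt_index Q"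
    unfolding witt_index_def by (smt (verit, best) mem_Collect_eq)
  have sub: "vec.subspace W" and Q0: "\<And>w. w \<in> W \<Longrightarrow> Q w = 0"
    using W by (auto simp: totally_singular_def)
  have "x \<in> W" if x: "x \<in> perp W" "Q x = 0" for x
  proof (rule ccontr)
    assume nx: "x \<notin> W"
    have span: "vec.span W = W" using sub by (simp add: vec.span_eq_iff)
    let ?X = "vec.span (insert x W)"
    have "Q y = 0" if "y \<in> ?X" for y
    proof -
      from that obtain k where k: "y - k *s x \<in> W" unfolding vec.span_insert span by blast
      define w where "w = y - k *s x"
      have "Q y = Q (k *s x + w)" by (simp add: w_def)
      also have "\<dots> = 0" using k x Q0 by (simp add: Q_add Q_scale B_left perp_def w_def[symmetric])
      finally show ?thesis .
    qed
    then have "totally_singular Q ?X" by (simp add: totally_singular_def)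
    then have "vec.dim ?X \<in> ?S" by (intro CollectI exI[of _ ?X]) simp
    then have "vec.dim ?X \<le> witt_index Q"
      unfolding witt_index_def by (rule Max_ge[OF fin])
    moreover have "x \<notin> vec.span W" by (subst span) (rule nx)
    then have "vec.dim ?X = Suc (vec.dim W)" by (simp add: vec.dim_insert)
    ultimately show False using W(2) by simp
  qed
  moreover have "x \<in> perp W" if x: "x \<in> W" for x
  proof -
    have "B x w = 0" if "w \<in> W" for w
      using Q_add[of x w] Q0 x that vec.subspace_add[OF sub x that] by simp
    then show ?thesis by (simp add: perp_def)
  qed
  ultimately have "{x \<in> perp W. Q x = 0} = W" using Q0 by blast
  then show thesis using that W by blast
qed

lemma q_gt_1: "q > 1"
proof -
  have "card {0, 1::'a} \<le> CARD('a)" by (rule card_mono) auto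
  then show ?thesis by (simp add: q_eq del: card_field)
qed

lemma gauss_from_witt_index:
  assumes "real (CARD('a) ^ witt_index Q) = w" "w * p = N"
  shows "(q - 1) * gauss = q * w - p"
proof -
  obtain W where W: "totally_singular Q W" "vec.dim W = witt_index Q" "{x \<in> perp W. Q x = 0} = W"
    by (rule obtain_maximal_totally_singular)
  then have cW: "real (card W) = w"
    using assms card_vec_subspace[of W] by (simp add: totally_singular_def)
  have "w > 0" using q_gt_1 unfolding assms(1)[symmetric] by simp
  then have "real (card (perp W)) = p"
    using card_perp[OF W(1)] cW assms(2) by (metis less_irrefl mult_left_cancel)
  then show ?thesis using gauss_value[OF W(1,3)] cW by simp
qed

lemma N_square: "CARD('n) = 2 * e \<Longrightarrow> N = q ^ e * q ^ e"
  by (simp add: N_eq mult_2 power_add)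

lemma gauss_hyperbolic:
  assumes "hyperbolic_form Q" "CARD('n) = 2 * e"
  shows "gauss = q ^ e"
proof -
  have "(q - 1) * gauss = q * q ^ e - q ^ e"
    using assms by (intro gauss_from_witt_index)
      (simp_all add: hyperbolic_form_def N_square[OF assms(2)])
  then have "(q - 1) * gauss = (q - 1) * q ^ e" by (simp add: algebra_simps)
  then show ?thesis using q_gt_1 by simp
qed

lemma gauss_elliptic:
  assumes "elliptic_form Q" "CARD('n) = 2 * e"
  shows "gauss = - (q ^ e)"
proof -
  from assms obtain d where d: "e = Suc d" "witt_index Q = d" by (auto simp: elliptic_form_def)
  have "(q - 1) * gauss = q * q ^ d - q * q * q ^ d"
    using assms d by (intro gauss_from_witt_index)
      (simp_all add: N_square[OF assms(2)])
  then have "(q - 1) * gauss = (q - 1) * (- (q ^ e))" by (simp add: algebra_simps d)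
  then show ?thesis using q_gt_1 by (metis less_irrefl mult_left_cancel right_minus_eq)
qed

lemma gauss_square: "gauss\<^sup>2 = N * (\<Sum>z\<in>perp UNIV. \<psi> (Q z))"
proof -
  have "gauss\<^sup>2 = (\<Sum>x\<in>UNIV. \<Sum>y\<in>UNIV. \<psi> (Q x) * \<psi> (Q y))"
    by (simp add: gauss_def power2_eq_square sum_product)
  also have "\<dots> = (\<Sum>x\<in>UNIV. \<Sum>z\<in>UNIV. \<psi> (Q z) * \<psi> (B z x))"
  proof (rule sum.cong[OF refl])
    fix x
    have "(\<Sum>y\<in>UNIV. \<psi> (Q x) * \<psi> (Q y)) = (\<Sum>z\<in>UNIV. \<psi> (Q x) * \<psi> (Q (z + x)))"
      by (rule sum.reindex_bij_witness[of _ "\<lambda>z. z + x" "\<lambda>z. z + x"]) (simp_all add: add.assoc)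
    then show "(\<Sum>y\<in>UNIV. \<psi> (Q x) * \<psi> (Q y)) = (\<Sum>z\<in>UNIV. \<psi> (Q z) * \<psi> (B z x))"
      by (simp add: Q_add psi_add ac_simps) (simp add: mult.assoc[symmetric])
  qed
  also have "\<dots> = (\<Sum>z\<in>UNIV. \<psi> (Q z) * (\<Sum>x\<in>UNIV. \<psi> (B z x)))"
    by (subst sum.swap) (simp only: sum_distrib_left)
  also have "\<dots> = (\<Sum>z\<in>UNIV. if z \<in> perp UNIV then N * \<psi> (Q z) else 0)"
    by (intro sum.cong refl) (simp add: sum_psi_polar)
  also have "\<dots> = N * (\<Sum>z\<in>perp UNIV. \<psi> (Q z))"
    by (simp add: sum.If_cases sum_distrib_left)
  finally show ?thesis .
qed

text \<open>
  Nondegeneracy allows a radical of the polar form on which \<open>Q\<close> does not vanish. A nonzero vector in it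
  could be scaled to \<open>Q y = 1\<close>, and translation by \<open>y\<close> would cancel the sum in \<open>gauss_square\<close>.
\<close>

lemma radical_trivial:
  assumes "gauss \<noteq> 0"
  shows "perp UNIV = {0}"
proof -
  have "z = 0" if z: "z \<in> perp UNIV" for z
  proof (rule ccontr)
    assume "z \<noteq> 0"
    then have "Q z \<noteq> 0" using nondeg z by (auto simp: nondegenerate_form_def perp_def)
    obtain b where b: "inverse (Q z) = b\<^sup>2" by (rule obtain_sqrt)
    define y where "y = b *s z"
    have "Q y = 1" using b \<open>Q z \<noteq> 0\<close> unfolding y_def by (metis Q_scale left_inverse)
    moreover have "B y x = 0" "B x y = 0" for x
      using z by (simp_all add: y_def B_left B_commute[of x] perp_def)
    ultimately have "(\<Sum>z\<in>perp UNIV. \<psi> (Q z)) = 0"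
      by (intro sum_translation_cancel[of y]) (simp_all add: Q_add psi_add psi_one perp_def B_left)
    then show False using assms gauss_square by simp
  qed
  moreover have "0 \<in> perp UNIV" by (simp add: perp_def B_left)
  ultimately show ?thesis by blast
qed

text \<open>
  The sum of \<open>\<psi> (a Q z)\<close> over all nonzero \<open>a\<close>: the contribution of the nontrivial characters to
  \<open>q\<close> times the indicator of the singular vectors.
\<close>

definition zero_weight :: "'a ^ 'n \<Rightarrow> real" where
  "zero_weight z = (if Q z = 0 then q - 1 else - 1)"

lemma zero_weight_eq_sum: "zero_weight z = (\<Sum>b\<in>UNIV - {0}. \<psi> (b\<^sup>2 * Q z))"
proof -
  have "(\<Sum>b\<in>UNIV. \<psi> (b\<^sup>2 * Q z)) = (\<Sum>a\<in>UNIV. \<psi> (a * Q z))"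
    by (rule sum.reindex_bij_betw[OF even_field_square_bij[OF even]])
  then have "(\<Sum>b\<in>UNIV. \<psi> (b\<^sup>2 * Q z)) = (if Q z = 0 then q else 0)"
    by (simp only: sum_psi_multiples)
  moreover have "(\<Sum>b\<in>UNIV. \<psi> (b\<^sup>2 * Q z)) = \<psi> (0\<^sup>2 * Q z) + (\<Sum>b\<in>UNIV - {0}. \<psi> (b\<^sup>2 * Q z))"
    by (rule sum.remove) auto
  ultimately show ?thesis by (auto simp: zero_weight_def)
qed

text \<open>
  Complete the square: \<open>b\<^sup>2 Q z + B z s = Q (b z + s / b) + Q s / b\<^sup>2\<close> in characteristic two. Summation over
  \<open>z\<close> gives \<open>gauss\<close>, and \<open>b \<mapsto> 1 / b\<close> permutes the nonzero scalars.
\<close>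

lemma zero_weight_fourier: "(\<Sum>z\<in>UNIV. zero_weight z * \<psi> (B z s)) = gauss * zero_weight s"
proof -
  have inner: "(\<Sum>z\<in>UNIV. \<psi> (b\<^sup>2 * Q z) * \<psi> (B z s)) = gauss * \<psi> ((inverse b)\<^sup>2 * Q s)"
    if b: "b \<noteq> 0" for b
  proof -
    have "\<psi> (b\<^sup>2 * Q z) * \<psi> (B z s) = \<psi> (Q (b *s z + inverse b *s s)) * \<psi> ((inverse b)\<^sup>2 * Q s)" for z
    proof -
      have "B (b *s z) (inverse b *s s) = B z s" using b by (simp add: B_left B_right)
      then have "\<psi> (Q (b *s z + inverse b *s s)) * \<psi> ((inverse b)\<^sup>2 * Q s)
          = \<psi> (b\<^sup>2 * Q z) * \<psi> (B z s) * (\<psi> ((inverse b)\<^sup>2 * Q s) * \<psi> ((inverse b)\<^sup>2 * Q s))"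
        by (simp only: Q_add Q_scale psi_add ac_simps)
      then show ?thesis by (simp only: psi_square mult_1_right)
    qed
    then have "(\<Sum>z\<in>UNIV. \<psi> (b\<^sup>2 * Q z) * \<psi> (B z s))
        = (\<Sum>z\<in>UNIV. \<psi> (Q (b *s z + inverse b *s s))) * \<psi> ((inverse b)\<^sup>2 * Q s)"
      by (simp only: sum_distrib_right)
    also have "(\<Sum>z\<in>UNIV. \<psi> (Q (b *s z + inverse b *s s))) = gauss"
    proof -
      have inv: "b *s (inverse b *s y) = y" "inverse b *s (b *s y) = y" for y :: "'a ^ 'n"
        using b by simp_all
      show ?thesis
        unfolding gauss_def
        by (rule sum.reindex_bij_witness[of _ "\<lambda>x. inverse b *s (x + inverse b *s s)"
              "\<lambda>z. b *s z + inverse b *s s"])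
          (simp_all only: inv add.assoc double_vec add_0_right UNIV_I)
    qed
    finally show ?thesis .
  qed
  have "(\<Sum>z\<in>UNIV. zero_weight z * \<psi> (B z s))
      = (\<Sum>b\<in>UNIV - {0}. \<Sum>z\<in>UNIV. \<psi> (b\<^sup>2 * Q z) * \<psi> (B z s))"
    unfolding zero_weight_eq_sum sum_distrib_right by (rule sum.swap)
  also have "\<dots> = (\<Sum>b\<in>UNIV - {0}. gauss * \<psi> ((inverse b)\<^sup>2 * Q s))"
    by (intro sum.cong refl inner) simp
  also have "\<dots> = (\<Sum>b\<in>UNIV - {0}. gauss * \<psi> (b\<^sup>2 * Q s))"
    by (rule sum.reindex_bij_witness[of _ inverse inverse]) auto
  also have "\<dots> = gauss * zero_weight s"
    by (simp only: zero_weight_eq_sum sum_distrib_left)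
  finally show ?thesis .
qed

lemma zero_weight_sum: "(\<Sum>z\<in>UNIV. zero_weight z) = (q - 1) * gauss"
  using zero_weight_fourier[of 0] by (simp add: B_right zero_weight_def)

text \<open>
  The Fourier transform maps the convolution of \<open>zero_weight\<close> with itself to its pointwise square, up
  to the factor \<open>gauss\<^sup>2\<close>. The values \<open>q - 1\<close> and \<open>- 1\<close> are the roots of
  \<open>y\<^sup>2 = (q - 2) y + (q - 1)\<close>, and transforming back gives the claim.
\<close>

lemma zero_weight_convolution:
  assumes g: "gauss \<noteq> 0"
  shows "(\<Sum>z\<in>UNIV. zero_weight z * zero_weight (z + s)) = (q - 2) * gauss * zero_weight s + (if s = 0 then (q - 1) * N else 0)"
proof -
  have "gauss * (\<Sum>z\<in>UNIV. zero_weight z * zero_weight (z + s))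
      = (\<Sum>z\<in>UNIV. \<Sum>r\<in>UNIV. zero_weight z * (zero_weight r * \<psi> (B r (z + s))))"
    by (simp only: sum_distrib_left[symmetric] zero_weight_fourier)
      (simp only: sum_distrib_left mult.left_commute)
  also have "\<dots> = (\<Sum>r\<in>UNIV. \<Sum>z\<in>UNIV. zero_weight r * \<psi> (B r s) * (zero_weight z * \<psi> (B z r)))"
    by (subst sum.swap) (simp add: B_right psi_add B_commute ac_simps)
  also have "\<dots> = (\<Sum>r\<in>UNIV. zero_weight r * \<psi> (B r s) * (gauss * zero_weight r))"
    by (simp only: sum_distrib_left[symmetric] zero_weight_fourier)
  also have "\<dots> = (\<Sum>r\<in>UNIV. gauss * ((q - 2) * (zero_weight r * \<psi> (B r s)) + (q - 1) * \<psi> (B s r)))"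
    by (intro sum.cong refl) (simp add: zero_weight_def B_commute algebra_simps)
  also have "\<dots> = gauss * ((q - 2) * (gauss * zero_weight s) + (q - 1) * (\<Sum>r\<in>UNIV. \<psi> (B s r)))"
    by (simp only: sum_distrib_left[symmetric] sum.distrib zero_weight_fourier)
  also have "(\<Sum>r\<in>UNIV. \<psi> (B s r)) = (if s = 0 then N else 0)"
    using radical_trivial[OF g] by (simp add: sum_psi_polar)
  finally show ?thesis using g by simp
qed

section \<open>Affine polar graphs\<close>

abbreviation "A \<equiv> adjacency_matrix (affine_polar_adj Q)"

lemma A_entry: "A $ x $ y = (1 + zero_weight (x + y)) / q - (if x = y then 1 else 0)"
  using q_gt_1 by (simp add: adjacency_matrix_def affine_polar_adj_def zero_weight_def diff_eq_add)

lemma A_row_sum: "(\<Sum>y\<in>UNIV. A $ x $ y) = (N + (q - 1) * gauss) / q - 1"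
proof -
  have "(\<Sum>y\<in>UNIV. zero_weight (x + y)) = (\<Sum>z\<in>UNIV. zero_weight z)"
    by (rule sum.reindex_bij_witness[of _ "(+) x" "(+) x"]) simp_all
  then show ?thesis
    by (simp add: A_entry sum_subtractf sum_divide_distrib[symmetric] sum.distrib zero_weight_sum)
qed

text \<open>
  The matrix \<open>A + 1\<close> has the entries \<open>(1 + zero_weight (x + y)) / q\<close>. Its square is computed by
  \<open>zero_weight_convolution\<close>. The resulting eigenvalues on sum-zero vectors are
  \<open>(q - 1) g - 1\<close> and \<open>- g - 1\<close>.
\<close>

lemma A_square:
  assumes g: "gauss = q * g" "N = q\<^sup>2 * g\<^sup>2" "g \<noteq> 0"
  shows "\<exists>c. A ** A = ((q - 2) * g - 2) *\<^sub>R A + (((q - 1) * g - 1) * (g + 1)) *\<^sub>R mat 1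
    + (\<chi> x y. c)"
proof -
  let ?S = "\<lambda>x z. (1 + zero_weight (x + z)) / q"
  let ?d = "\<lambda>x z. if x = z then 1 else 0 :: real"
  define c where "c = (N + 2 * ((q - 1) * gauss) - (q - 2) * gauss) / q\<^sup>2"
  have q0: "q \<noteq> 0" using q_gt_1 by linarith
  have g0: "gauss \<noteq> 0" using g q0 by simp
  have "(A ** A) $ x $ y = (((q - 2) * g - 2) *\<^sub>R A + (((q - 1) * g - 1) * (g + 1)) *\<^sub>R mat 1
    + (\<chi> x y. c)) $ x $ y" for x y
  proof -
    have shift: "(\<Sum>z\<in>UNIV. f (x + z)) = (\<Sum>z\<in>UNIV. f z)" for x :: "'a ^ 'n" and f :: "_ \<Rightarrow> real"
      by (rule sum.reindex_bij_witness[of _ "(+) x" "(+) x"]) simp_all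
    have conv: "(\<Sum>z\<in>UNIV. zero_weight (x + z) * zero_weight (z + y)) = (\<Sum>z\<in>UNIV. zero_weight z * zero_weight (z + (x + y)))"
      using shift[of "\<lambda>z. zero_weight z * zero_weight (z + (x + y))" x]
      by (simp add: add.commute add.left_commute add.assoc)
    have SS: "(\<Sum>z\<in>UNIV. ?S x z * ?S z y)
        = (N + 2 * ((q - 1) * gauss) + (\<Sum>z\<in>UNIV. zero_weight z * zero_weight (z + (x + y)))) / q\<^sup>2"
    proof -
      have "(\<Sum>z\<in>UNIV. ?S x z * ?S z y)
          = (\<Sum>z\<in>UNIV. 1 + zero_weight (x + z) + zero_weight (y + z) + zero_weight (x + z) * zero_weight (z + y)) / q\<^sup>2"
        unfolding sum_divide_distrib
        by (intro sum.cong refl) (simp add: power2_eq_square algebra_simps add_divide_distrib add.commute[of y])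
      then show ?thesis by (simp add: sum.distrib shift zero_weight_sum conv)
    qed
    have "(A ** A) $ x $ y = (\<Sum>z\<in>UNIV. (?S x z - ?d x z) * (?S z y - ?d z y))"
      by (simp add: matrix_matrix_mult_def A_entry)
    also have "\<dots> = (\<Sum>z\<in>UNIV. ?S x z * ?S z y) - (\<Sum>z\<in>UNIV. ?S x z * ?d z y)
       - (\<Sum>z\<in>UNIV. ?d x z * ?S z y) + (\<Sum>z\<in>UNIV. ?d x z * ?d z y)"
      by (simp only: left_diff_distrib right_diff_distrib sum_subtractf)
    also have "(\<Sum>z\<in>UNIV. ?S x z * ?d z y) = ?S x y"
      by (subst sum.mono_neutral_right[of UNIV "{y}"]) auto
    also have "(\<Sum>z\<in>UNIV. ?d x z * ?S z y) = ?S x y"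
      by (subst sum.mono_neutral_right[of UNIV "{x}"]) auto
    also have "(\<Sum>z\<in>UNIV. ?d x z * ?d z y) = ?d x y"
      by (subst sum.mono_neutral_right[of UNIV "{x}"]) auto
    finally have AA: "(A ** A) $ x $ y = (\<Sum>z\<in>UNIV. ?S x z * ?S z y) - ?S x y - ?S x y + ?d x y" .
    have s0: "x + y = 0 \<longleftrightarrow> x = y" by (metis diff_eq_add eq_iff_diff_eq_0)
    define Z where "Z = zero_weight (x + y)"
    define \<delta> where "\<delta> = ?d x y"
    have "(A ** A) $ x $ y = (N + 2 * ((q - 1) * gauss) + ((q - 2) * gauss * Z + \<delta> * ((q - 1) * N))) / q\<^sup>2
        - (1 + Z) / q - (1 + Z) / q + \<delta>"
      unfolding AA SS zero_weight_convolution[OF g0] Z_def \<delta>_def s0 by simp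
    also have "\<dots> = ((q - 2) * g - 2) * ((1 + Z) / q - \<delta>) + (((q - 1) * g - 1) * (g + 1)) * \<delta> + c"
      unfolding c_def g(1) g(2) using q0 by (simp add: field_simps power2_eq_square)
    also have "\<dots> = (((q - 2) * g - 2) *\<^sub>R A + (((q - 1) * g - 1) * (g + 1)) *\<^sub>R mat 1
        + (\<chi> x y. c)) $ x $ y"
      by (simp add: A_entry mat_def Z_def \<delta>_def)
    finally show ?thesis .
  qed
  then have "A ** A = ((q - 2) * g - 2) *\<^sub>R A + (((q - 1) * g - 1) * (g + 1)) *\<^sub>R mat 1
    + (\<chi> x y. c)"
    by (simp only: vec_eq_iff simp_thms)
  then show ?thesis by blast
qed

end

section \<open>State transfer on affine polar graphs\<close>

context even_quadratic_form
begin

lemma perturbed_pair_A: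
  assumes uv: "u \<noteq> v" "\<not> affine_polar_adj Q u v"
    and g: "gauss = q * g" "N = q\<^sup>2 * g\<^sup>2" "g \<noteq> 0"
    and par: "\<theta> + \<tau> = (q - 2) * g - 2" "\<theta> * \<tau> = - (((q - 1) * g - 1) * (g + 1))"
  shows "\<exists>c. perturbed_pair A u v \<theta> \<tau> (q * g\<^sup>2 + (q - 1) * g - 1) c"
proof -
  obtain c where c: "A ** A = ((q - 2) * g - 2) *\<^sub>R A + (((q - 1) * g - 1) * (g + 1)) *\<^sub>R mat 1
    + (\<chi> x y. c)"
    using A_square[OF g] by blast
  have "perturbed_pair A u v \<theta> \<tau> (q * g\<^sup>2 + (q - 1) * g - 1) c"
  proof
    show "A $ u $ u = 0" "A $ u $ v = 0" "A $ v $ u = 0" "A $ v $ v = 0"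
      using uv by (simp_all add: adjacency_matrix_def affine_polar_adj_def diff_eq_add add.commute)
    show "A ** A = (\<theta> + \<tau>) *\<^sub>R A - (\<theta> * \<tau>) *\<^sub>R mat 1 + (\<chi> x y. c)"
      unfolding c par by simp
    show "(\<Sum>y\<in>UNIV. A $ x $ y) = q * g\<^sup>2 + (q - 1) * g - 1" for x
      unfolding A_row_sum using g q_gt_1 by (simp add: field_simps power2_eq_square)
  qed (rule uv(1))
  then show ?thesis by blast
qed

lemma N_gauss:
  assumes "CARD('n) = 2 * e" "gauss = s * q ^ e" "s\<^sup>2 = 1" "e = Suc d"
  shows "gauss = q * (s * q ^ d)" "N = q\<^sup>2 * (s * q ^ d)\<^sup>2" "s * q ^ d \<noteq> 0"
  using q_gt_1 assms(2,3) unfolding N_square[OF assms(1)] assms(4)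
  by (auto simp: power_mult_distrib power2_eq_square)

text \<open>
  Here \<open>\<theta> = (q - 1) q^(e - 1) - 1\<close> and \<open>\<tau> = - q^(e - 1) - 1\<close>. The latter is odd exactly if \<open>e \<ge> 2\<close>.
  For \<open>e = 1\<close> the graph is the \<open>q\<close> by \<open>q\<close> rook's graph with \<open>\<tau> = - 2\<close>, and since \<open>q\<close> is a
  power of two other than 4, it is 2 or a multiple of 8.
\<close>

lemma hyperbolic_pst:
  assumes uv: "u \<noteq> v" "\<not> affine_polar_adj Q u v"
    and hyp: "hyperbolic_form Q" and e: "CARD('n) = 2 * e"
    and excl: "\<not> (e = 1 \<and> CARD('a) = 4)"
  shows "\<exists>\<beta>\<in>\<rat>. perfect_state_transfer (perturbation A u v \<beta> (- \<beta>)) u v"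
proof -
  have "CARD('n) > 0" by simp
  with e obtain d where d: "e = Suc d" by (cases e) auto
  let ?g = "q ^ d"
  have g: "gauss = q * ?g" "N = q\<^sup>2 * ?g\<^sup>2" "?g \<noteq> 0"
    using N_gauss[OF e _ _ d, of 1] gauss_hyperbolic[OF hyp e] by simp_all
  let ?\<theta> = "(q - 1) * ?g - 1" and ?\<tau> = "- ?g - 1"
  obtain c where "perturbed_pair A u v ?\<theta> ?\<tau> (q * ?g\<^sup>2 + (q - 1) * ?g - 1) c"
    using perturbed_pair_A[OF uv g, of ?\<theta> ?\<tau>] by (auto simp: algebra_simps)
  then interpret p: perturbed_pair A u v ?\<theta> ?\<tau> "q * ?g\<^sup>2 + (q - 1) * ?g - 1" c .
  have k: "q * ?g\<^sup>2 + (q - 1) * ?g - 1 = ?\<theta> + (?\<theta> - ?\<tau>) * of_int (int CARD('a) ^ d)"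
    by (simp add: algebra_simps power2_eq_square)
  show ?thesis
  proof (cases d)
    case (Suc d')
    obtain m where m: "CARD('a) = 2 * m" using even by (elim evenE)
    have mpos: "m > 0" using m q_gt_1 by (cases m) (auto simp: q_eq simp del: card_field)
    let ?D = "int m * int m * int CARD('a) ^ d'" and ?t = "- (int CARD('a) ^ d) - 1"
    have D: "?\<theta> - ?\<tau> = 4 * 1 * of_int ?D" using m by (simp add: Suc algebra_simps) (simp add: q_eq m del: card_field)
    have t: "?\<tau> = 1 * of_int ?t" by simp
    have Dpos: "?D > 0" using mpos m by simp
    have odd: "odd ?t" using even by (simp add: Suc)
    have "0 \<le> int CARD('a) ^ d" by simp
    then have neg: "?t < 0" by linarith
    show ?thesis
      by (rule p.perfect_state_transfer_2_adic[OF D t _ Dpos odd neg k]) simp_all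
  next
    case 0
    obtain m where m: "CARD('a) = 2 ^ m" using even_field_card_power_of_two[OF even] by blast
    show ?thesis
    proof (cases "m \<ge> 3")
      case True
      then obtain l where l: "m = l + 3" using le_Suc_ex[of 3 m] by (auto simp: add.commute)
      have D: "?\<theta> - ?\<tau> = 4 * 2 * of_int (2 ^ l)" using m l by (simp add: q_eq 0 power_add del: card_field)
      have t: "?\<tau> = 2 * of_int (- 1)" by (simp add: 0)
      show ?thesis by (rule p.perfect_state_transfer_2_adic[OF D t _ _ _ _ k]) simp_all
    next
      case False
      moreover have "m \<noteq> 2" using excl m d 0 by auto
      moreover have "m \<noteq> 0" using m q_gt_1 by (cases m) (auto simp: q_eq simp del: card_field)
      ultimately have "m = 1" by linarith
      then have q2: "CARD('a) = 2" using m by simp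
      have "perfect_state_transfer (p.M 0) u v"
      proof (rule p.perfect_state_transfer_four_cycle)
        show "CARD('a ^ 'n) = 4" using e d 0 q2 by simp
        show "q * ?g\<^sup>2 + (q - 1) * ?g - 1 = 2" by (simp add: 0 q_eq q2 del: card_field)
        show "A $ x $ y \<le> 1" for x y by (simp add: adjacency_matrix_def)
        show "A $ x $ y = A $ y $ x" for x y by (auto simp: A_entry add.commute)
      qed
      then show ?thesis by (intro bexI[of _ 0]) auto
    qed
  qed
qed

text \<open>
  The sign of the Gauss sum exchanges the roles of the eigenvalues: \<open>\<theta> = q^(e - 1) - 1\<close> and
  \<open>\<tau> = - (q - 1) q^(e - 1) - 1\<close>. For \<open>e = 1\<close> the valency is 0, so the graph has no edges.
\<close>

lemma elliptic_pst:
  assumes uv: "u \<noteq> v" "\<not> affine_polar_adj Q u v"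
    and ell: "elliptic_form Q" and e: "CARD('n) = 2 * e"
  shows "\<exists>\<beta>\<in>\<rat>. perfect_state_transfer (perturbation A u v \<beta> (- \<beta>)) u v"
proof -
  have "CARD('n) > 0" by simp
  with e obtain d where d: "e = Suc d" by (cases e) auto
  let ?g = "- (q ^ d)"
  have g: "gauss = q * ?g" "N = q\<^sup>2 * ?g\<^sup>2" "?g \<noteq> 0"
    using N_gauss[OF e _ _ d, of "- 1"] gauss_elliptic[OF ell e] by simp_all
  let ?\<theta> = "- ?g - 1" and ?\<tau> = "(q - 1) * ?g - 1"
  obtain c where "perturbed_pair A u v ?\<theta> ?\<tau> (q * ?g\<^sup>2 + (q - 1) * ?g - 1) c"
    using perturbed_pair_A[OF uv g, of ?\<theta> ?\<tau>] by (auto simp: algebra_simps)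
  then interpret p: perturbed_pair A u v ?\<theta> ?\<tau> "q * ?g\<^sup>2 + (q - 1) * ?g - 1" c .
  have k: "q * ?g\<^sup>2 + (q - 1) * ?g - 1 = ?\<theta> + (?\<theta> - ?\<tau>) * of_int (int CARD('a) ^ d - 1)"
    by (simp add: algebra_simps power2_eq_square)
  show ?thesis
  proof (cases d)
    case (Suc d')
    obtain m where m: "CARD('a) = 2 * m" using even by (elim evenE)
    have mpos: "m > 0" using m q_gt_1 by (cases m) (auto simp: q_eq simp del: card_field)
    let ?D = "int m * int m * int CARD('a) ^ d'"
      and ?t = "- ((int CARD('a) - 1) * int CARD('a) ^ d) - 1"
    have D: "?\<theta> - ?\<tau> = 4 * 1 * of_int ?D" using m by (simp add: Suc algebra_simps) (simp add: q_eq m del: card_field)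
    have t: "?\<tau> = 1 * of_int ?t" by simp
    have Dpos: "?D > 0" using mpos m by simp
    have odd: "odd ?t" using even by (simp add: Suc)
    have "0 \<le> (int CARD('a) - 1) * int CARD('a) ^ d"
      using m mpos by (intro mult_nonneg_nonneg) auto
    then have neg: "?t < 0" by linarith
    show ?thesis
      by (rule p.perfect_state_transfer_2_adic[OF D t _ Dpos odd neg k]) simp_all
  next
    case 0
    have "A $ x $ y = 0" for x y
    proof -
      have "(\<Sum>y\<in>UNIV. A $ x $ y) = 0" using p.row_sum by (simp add: 0)
      then have "\<forall>y\<in>UNIV. A $ x $ y = 0"
        by (subst (asm) sum_nonneg_eq_0_iff) (simp_all add: adjacency_matrix_def)
      then show ?thesis by simp
    qed
    then have "A = 0" by (simp add: vec_eq_iff)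
    then have "perfect_state_transfer (p.M 1) u v" by (rule p.perfect_state_transfer_edgeless)
    then show ?thesis by (intro bexI[of _ 1]) auto
  qed
qed

end

theorem theorem19:
  fixes Q :: "'a::{field,finite} ^ 'n \<Rightarrow> 'a"
    and e q :: nat
    and u v :: "'a ^ 'n"
  assumes "CARD('a) = q"
    and "CARD('n) = 2 * e"
    and "elliptic_form Q \<or> hyperbolic_form Q"
    and "u \<noteq> v"
    and "\<not> affine_polar_adj Q u v"
    and "even q"
    and "\<not> (hyperbolic_form Q \<and> e = 1 \<and> q = 4)"
  shows "\<exists>\<beta> \<gamma> :: real. \<beta> + \<gamma> = 0 \<and> \<beta> \<in> \<rat> \<and>
    perfect_state_transfer (perturbation (adjacency_matrix (affine_polar_adj Q)) u v \<beta> \<gamma>) u v"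
proof -
  have ev: "even CARD('a)" using assms(1,6) by simp
  obtain \<psi> :: "'a \<Rightarrow> real" where \<psi>: "\<forall>x y. \<psi> (x + y) = \<psi> x * \<psi> y" "\<psi> 1 = - 1"
    using even_field_additive_character[OF ev] by blast
  interpret even_quadratic_form Q \<psi> "real CARD('a)" "real CARD('a) ^ CARD('n)"
    by unfold_locales (use ev \<psi> assms(3) in \<open>auto simp: elliptic_form_def hyperbolic_form_def\<close>)
  have "\<exists>\<beta>\<in>\<rat>. perfect_state_transfer (perturbation A u v \<beta> (- \<beta>)) u v"
    using assms(3)
  proof
    assume "elliptic_form Q"
    then show ?thesis by (rule elliptic_pst[OF assms(4,5) _ assms(2)])
  next
    assume hyp: "hyperbolic_form Q"
    then have "\<not> (e = 1 \<and> CARD('a) = 4)" using assms(1,7) by blast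
    then show ?thesis by (rule hyperbolic_pst[OF assms(4,5) hyp assms(2)])
  qed
  then obtain \<beta> where "\<beta> \<in> \<rat>" "perfect_state_transfer (perturbation A u v \<beta> (- \<beta>)) u v" by blast
  then show ?thesis by (intro exI[of _ \<beta>] exI[of _ "- \<beta>"]) simp
qed

end
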